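(* The property of being a Wilder continuum is not a Whitney reversible property. That is, there exists a continuum $X$ which is not a Wilder continuum such that, for each Whitney map $\mu : C(X) \to [0,\mu(X)]$ and each $t \in (0,\mu(X))$, $\mu^{-1}(t)$ is a Wilder continuum.
   Context: All spaces are metrizable. A continuum is a (nonempty) compact connected metric space. A subcontinuum of $X$ is a subset of $X$ that is a continuum. For a continuum $X$, $C(X)$ is the space of all nonempty subcontinua of $X$ with the topology induced by the Hausdorff metric. A Whitney map for $C(X)$ is a continuous map $\mu : C(X) \to [0,\mu(X)]$ such that $\mu(\{x\}) = 0$ for each $x \in X$ and $\mu(A) < \mu(B)$ whenever $A, B \in C(X)$ and $A \subsetneq B$. It is known that $\mu^{-1}(t)$ is a continuum for each $t \in [0,\mu(X)]$. A topological property $P$ is a Whitney reversible property provided that whenever $X$ is a continuum such that $\mu^{-1}(t)$ has property $P$ for each Whitney map $\mu$ for $C(X)$ and for each $t \in (0,\mu(X))$, then $X$ has property $P$. A continuum $Y$ is called a Wilder continuum if for any three distinct points $x, y, z \in Y$ there exists a subcontinuum $C$ of $Y$ such that $x \in C$ and $C$ contains exactly one of $y$ and $z$. *)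

theory Defs
  imports "HOL-Analysis.Analysis"
begin

section \<open>Continua and Wilder continua\<close>

definition continuum :: "'a topology \<Rightarrow> bool" where
  "continuum X \<longleftrightarrow>
     topspace X \<noteq> {} \<and> metrizable_space X \<and> compact_space X \<and> connected_space X"

definition subcontinuum :: "'a topology \<Rightarrow> 'a set \<Rightarrow> bool" where
  "subcontinuum X A \<longleftrightarrow> A \<subseteq> topspace X \<and> continuum (subtopology X A)"

definition wilder_continuum :: "'a topology \<Rightarrow> bool" where
  "wilder_continuum Y \<longleftrightarrow>
     continuum Y \<and>
     (\<forall>x\<in>topspace Y. \<forall>y\<in>topspace Y. \<forall>z\<in>topspace Y.
        x \<noteq> y \<and> x \<noteq> z \<and> y \<noteq> z \<longrightarrow>
        (\<exists>C. subcontinuum Y C \<and> x \<in> C \<and> (y \<in> C \<longleftrightarrow> z \<notin> C)))"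

lemma homeomorphic_map_continuum:
  assumes "homeomorphic_map X Y f"
  shows "continuum X \<longleftrightarrow> continuum Y"
proof -
  have "X homeomorphic_space Y"
    using assms homeomorphic_map_imp_homeomorphic_space by blast
  then show ?thesis
    by (simp add: continuum_def homeomorphic_empty_space homeomorphic_compact_space
        homeomorphic_connected_space homeomorphic_metrizable_space)
qed

lemma homeomorphic_map_subcontinuum:
  assumes f: "homeomorphic_map X Y f" and A: "subcontinuum X A"
  shows "subcontinuum Y (f ` A)"
proof -
  have sub: "A \<subseteq> topspace X" using A by (simp add: subcontinuum_def)
  have im: "f ` topspace X = topspace Y"
    using f homeomorphic_imp_surjective_map by blast
  have "homeomorphic_map (subtopology X A) (subtopology Y (f ` A)) f"
    using sub im by (intro homeomorphic_map_subtopologies[OF f]) blast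
  then show ?thesis
    using A im sub homeomorphic_map_continuum[of "subtopology X A" "subtopology Y (f ` A)" f]
    by (auto simp: subcontinuum_def)
qed

lemma homeomorphic_space_wilder_continuum:
  assumes "X homeomorphic_space Y" and W: "wilder_continuum X"
  shows "wilder_continuum Y"
proof -
  obtain f g where fg: "homeomorphic_maps X Y f g"
    using assms homeomorphic_space_def by blast
  have f: "homeomorphic_map X Y f" and g: "homeomorphic_map Y X g"
    using fg homeomorphic_maps_map by blast+
  have gf: "f (g y) = y" "g y \<in> topspace X" if "y \<in> topspace Y" for y
    using fg that by (auto simp: homeomorphic_maps_def continuous_map_def)
  have fgx: "g (f x) = x" if "x \<in> topspace X" for x
    using fg that by (auto simp: homeomorphic_maps_def)
  show ?thesis
    unfolding wilder_continuum_def
  proof (intro conjI ballI impI)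
    show "continuum Y"
      using W homeomorphic_map_continuum[OF f] by (simp add: wilder_continuum_def)
  next
    fix x y z
    assume xyz: "x \<in> topspace Y" "y \<in> topspace Y" "z \<in> topspace Y"
      and ne: "x \<noteq> y \<and> x \<noteq> z \<and> y \<noteq> z"
    have "g x \<noteq> g y \<and> g x \<noteq> g z \<and> g y \<noteq> g z"
      using gf xyz ne by metis
    then obtain C where C: "subcontinuum X C" "g x \<in> C" "g y \<in> C \<longleftrightarrow> g z \<notin> C"
      using W gf xyz unfolding wilder_continuum_def by meson
    have mem: "u \<in> f ` C \<longleftrightarrow> g u \<in> C" if "u \<in> topspace Y" for u
    proof
      assume "u \<in> f ` C"
      then obtain c where "c \<in> C" "u = f c" by blast
      moreover have "c \<in> topspace X"
        using C(1) \<open>c \<in> C\<close> by (auto simp: subcontinuum_def)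
      ultimately show "g u \<in> C" using fgx by simp
    next
      assume "g u \<in> C"
      then show "u \<in> f ` C" using gf(1)[OF that] by (metis imageI)
    qed
    show "\<exists>C. subcontinuum Y C \<and> x \<in> C \<and> (y \<in> C \<longleftrightarrow> z \<notin> C)"
      using homeomorphic_map_subcontinuum[OF f C(1)] C(2,3) xyz
      by (intro exI[of _ "f ` C"]) (simp add: mem)
  qed
qed


section \<open>The hyperspace of subcontinua\<close>

text \<open>The value 0 outside the nonempty compact sets is a dummy: a \<open>Metric_space\<close> distance must be
  nonnegative and symmetric on the whole type.\<close>

definition hausdorff_dist :: "'a metric \<Rightarrow> 'a set \<Rightarrow> 'a set \<Rightarrow> real" where
  "hausdorff_dist X A B =
     (if A \<noteq> {} \<and> B \<noteq> {} \<and> compactin (mtopology_of X) A \<and> compactin (mtopology_of X) B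
      then max (SUP a\<in>A. INF b\<in>B. mdist X a b) (SUP b\<in>B. INF a\<in>A. mdist X b a)
      else 0)"

definition subcontinua :: "'a metric \<Rightarrow> 'a set metric" where
  "subcontinua X = metric ({A. subcontinuum (mtopology_of X) A}, hausdorff_dist X)"

lemma subcontinuum_compactin:
  assumes "subcontinuum (mtopology_of X) A"
  shows "A \<noteq> {}" "A \<subseteq> mspace X" "compactin (mtopology_of X) A"
  using assms
  by (auto simp: subcontinuum_def continuum_def compactin_subspace)

context
  fixes X :: "'a metric"
begin

interpretation M: Metric_space "mspace X" "mdist X" by blast

private lemma mtop_eq: "M.mtopology = mtopology_of X"
  by (simp add: mtopology_of_def)

private definition semi :: "'a set \<Rightarrow> 'a set \<Rightarrow> real" where
  "semi A B = (SUP a\<in>A. INF b\<in>B. mdist X a b)"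

private definition ok :: "'a set \<Rightarrow> bool" where
  "ok A \<longleftrightarrow> A \<noteq> {} \<and> compactin (mtopology_of X) A"

private lemma ok_sub: "ok A \<Longrightarrow> A \<subseteq> mspace X"
  using compactin_subset_topspace by (fastforce simp: ok_def)

private lemma bdd_inf [simp]: "bdd_below ((\<lambda>b. mdist X a b) ` B)"
  by (rule bdd_belowI[of _ 0]) auto

private lemma inf_nonneg: "B \<noteq> {} \<Longrightarrow> 0 \<le> (INF b\<in>B. mdist X a b)"
  by (auto intro: cINF_greatest)

private lemma inf_le: "b \<in> B \<Longrightarrow> (INF b\<in>B. mdist X a b) \<le> mdist X a b"
  by (auto intro: cINF_lower)

private lemma bdd_sup:
  assumes "ok A" "ok B"
  shows "bdd_above ((\<lambda>a. INF b\<in>B. mdist X a b) ` A)"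
proof -
  obtain b where b: "b \<in> B" using assms by (auto simp: ok_def)
  have bX: "b \<in> mspace X" using b assms ok_sub by blast
  have "M.mbounded (insert b A)"
    using assms(1) bX M.compactin_imp_mbounded by (simp add: ok_def mtop_eq M.mbounded_insert)
  then obtain K where K: "\<And>x y. x \<in> insert b A \<Longrightarrow> y \<in> insert b A \<Longrightarrow> mdist X x y \<le> K"
    by (meson M.mbounded_alt)
  have "(INF b\<in>B. mdist X a b) \<le> K" if "a \<in> A" for a
    using inf_le[OF b, of a] K[of a b] that by simp
  then show ?thesis
    by (intro bdd_aboveI[of _ K]) auto
qed

private lemma semi_ge:
  assumes "ok A" "ok B" "a \<in> A"
  shows "(INF b\<in>B. mdist X a b) \<le> semi A B"
  unfolding semi_def using assms bdd_sup by (auto intro: cSUP_upper)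

private lemma semi_nonneg:
  assumes "ok A" "ok B"
  shows "0 \<le> semi A B"
proof -
  obtain a where "a \<in> A" using assms by (auto simp: ok_def)
  then show ?thesis
    using semi_ge[OF assms] inf_nonneg[of B a] assms(2) by (fastforce simp: ok_def)
qed

private lemma semi_triangle:
  assumes "ok A" "ok B" "ok C"
  shows "semi A C \<le> semi A B + semi B C"
proof -
  have "(INF c\<in>C. mdist X a c) \<le> semi A B + semi B C" if a: "a \<in> A" for a
  proof -
    have aX: "a \<in> mspace X" using a assms ok_sub by blast
    have "(INF c\<in>C. mdist X a c) - semi B C \<le> mdist X a b" if b: "b \<in> B" for b
    proof -
      have bX: "b \<in> mspace X" using b assms ok_sub by blast
      have "(INF c\<in>C. mdist X a c) - mdist X a b \<le> mdist X b c" if c: "c \<in> C" for c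
      proof -
        have "c \<in> mspace X" using c assms ok_sub by blast
        then show ?thesis
          using inf_le[OF c, of a] M.triangle[OF aX bX, of c] by simp
      qed
      then have "(INF c\<in>C. mdist X a c) - mdist X a b \<le> (INF c\<in>C. mdist X b c)"
        using assms(3) by (auto simp: ok_def intro: cINF_greatest)
      also have "\<dots> \<le> semi B C" using semi_ge assms b by blast
      finally show ?thesis by simp
    qed
    then have "(INF c\<in>C. mdist X a c) - semi B C \<le> (INF b\<in>B. mdist X a b)"
      using assms(2) by (auto simp: ok_def intro: cINF_greatest)
    also have "\<dots> \<le> semi A B" using semi_ge assms a by blast
    finally show ?thesis by simp
  qed
  then show ?thesis
    unfolding semi_def[of A C] using assms(1) by (auto simp: ok_def intro: cSUP_least)
qed

private lemma semi_le_0_iff: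
  assumes "ok A" "ok B"
  shows "semi A B \<le> 0 \<longleftrightarrow> A \<subseteq> B"
proof
  assume le: "semi A B \<le> 0"
  show "A \<subseteq> B"
  proof
    fix a assume a: "a \<in> A"
    have aX: "a \<in> mspace X" using a assms ok_sub by blast
    have cl: "closedin M.mtopology B"
      using assms(2) M.Hausdorff_space_mtopology compactin_imp_closedin
      by (auto simp: ok_def mtop_eq)
    have "(INF b\<in>B. mdist X a b) \<le> 0" using semi_ge[OF assms a] le by linarith
    then have "\<exists>b\<in>B. mdist X a b < r" if "r > 0" for r
      using that assms(2) cINF_less_iff[of B "\<lambda>b. mdist X a b" r] by (auto simp: ok_def)
    then have "a \<in> M.mtopology closure_of B"
      using aX ok_sub[OF assms(2)] by (auto simp: M.metric_closure_of)
    then show "a \<in> B" using cl closure_of_closedin by blast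
  qed
next
  assume sub: "A \<subseteq> B"
  have "(INF b\<in>B. mdist X a b) \<le> 0" if a: "a \<in> A" for a
    using inf_le[of a B a] a sub assms ok_sub by (metis M.mdist_zero subsetD)
  then show "semi A B \<le> 0"
    unfolding semi_def using assms(1) by (auto simp: ok_def intro: cSUP_least)
qed

private lemma hausdorff_dist_semi:
  "hausdorff_dist X A B = (if ok A \<and> ok B then max (semi A B) (semi B A) else 0)"
  by (auto simp: hausdorff_dist_def ok_def semi_def)

lemma Metric_space_hausdorff_dist:
  "Metric_space {A. subcontinuum (mtopology_of X) A} (hausdorff_dist X)"
proof
  fix A B :: "'a set"
  show "0 \<le> hausdorff_dist X A B"
    by (auto simp: hausdorff_dist_semi le_max_iff_disj intro: semi_nonneg)
  show "hausdorff_dist X A B = hausdorff_dist X B A"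
    by (simp add: hausdorff_dist_semi max.commute)
next
  fix A B :: "'a set"
  assume "A \<in> {A. subcontinuum (mtopology_of X) A}" "B \<in> {A. subcontinuum (mtopology_of X) A}"
  then have ok: "ok A" "ok B"
    using subcontinuum_compactin by (auto simp: ok_def)
  have "hausdorff_dist X A B = 0 \<longleftrightarrow> semi A B \<le> 0 \<and> semi B A \<le> 0"
    using ok semi_nonneg[OF ok] by (auto simp: hausdorff_dist_semi max_def)
  then show "hausdorff_dist X A B = 0 \<longleftrightarrow> A = B"
    using ok semi_le_0_iff by auto
next
  fix A B C :: "'a set"
  assume "A \<in> {A. subcontinuum (mtopology_of X) A}" "B \<in> {A. subcontinuum (mtopology_of X) A}"
    "C \<in> {A. subcontinuum (mtopology_of X) A}"
  then have ok: "ok A" "ok B" "ok C"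
    using subcontinuum_compactin by (auto simp: ok_def)
  show "hausdorff_dist X A C \<le> hausdorff_dist X A B + hausdorff_dist X B C"
    using ok semi_triangle[of A B C] semi_triangle[of C B A]
    by (simp add: hausdorff_dist_semi) linarith
qed

lemma mspace_subcontinua: "mspace (subcontinua X) = {A. subcontinuum (mtopology_of X) A}"
  and mdist_subcontinua: "mdist (subcontinua X) = hausdorff_dist X"
  using Metric_space.mspace_metric[OF Metric_space_hausdorff_dist]
    Metric_space.mdist_metric[OF Metric_space_hausdorff_dist]
  by (simp_all add: subcontinua_def)

end


section \<open>Whitney maps and Whitney reversible properties\<close>

text \<open>The values of \<open>\<mu>\<close> matter only on the subcontinua of \<open>X\<close>.\<close>

definition whitney_map :: "'a metric \<Rightarrow> ('a set \<Rightarrow> real) \<Rightarrow> bool" where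
  "whitney_map X \<mu> \<longleftrightarrow>
     continuous_map (mtopology_of (subcontinua X)) (top_of_set {0..\<mu> (mspace X)}) \<mu> \<and>
     (\<forall>x\<in>mspace X. \<mu> {x} = 0) \<and>
     (\<forall>A\<in>mspace (subcontinua X). \<forall>B\<in>mspace (subcontinua X). A \<subset> B \<longrightarrow> \<mu> A < \<mu> B)"

definition whitney_level :: "'a metric \<Rightarrow> ('a set \<Rightarrow> real) \<Rightarrow> real \<Rightarrow> 'a set topology" where
  "whitney_level X \<mu> t =
     subtopology (mtopology_of (subcontinua X)) {A \<in> mspace (subcontinua X). \<mu> A = t}"

text \<open>A topological property is a polymorphic predicate on topologies. HOL cannot abstract over such
  a predicate, so its instance \<open>P\<close> for spaces of points and its instance \<open>Q\<close> for spaces of sets of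
  points are separate arguments. The continua \<open>X\<close> range over those with points in \<open>'a\<close>; for
  \<open>'a = nat \<Rightarrow> real\<close> this is every continuum up to isometry.\<close>

definition whitney_reversible :: "('a topology \<Rightarrow> bool) \<Rightarrow> ('a set topology \<Rightarrow> bool) \<Rightarrow> bool" where
  "whitney_reversible P Q \<longleftrightarrow>
     (\<forall>X. continuum (mtopology_of X) \<and>
          (\<forall>\<mu>. whitney_map X \<mu> \<longrightarrow> (\<forall>t\<in>{0<..<\<mu> (mspace X)}. Q (whitney_level X \<mu> t)))
        \<longrightarrow> P (mtopology_of X))"

end

theory Submission
  imports Defs
begin

text \<open>
  Why the theorem holds. If a continuum is not Wilder, some point \<open>x\<close> sees two points \<open>y\<close>, \<open>z\<close> as
  inseparable: a subcontinuum joining \<open>x\<close> to one of them contains the other. The counterexample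
  consists of a circle \<open>D\<close> and a graph wrapping around it, such that every subcontinuum that meets
  both \<open>D\<close> and its complement swallows all of \<open>D\<close>. Hence no two points of \<open>D\<close> can be separated from
  a point outside, and the space is not Wilder.

  In a Whitney level with \<open>0 < t < \<mu> D\<close> the place of \<open>D\<close> is taken by the set of all arcs of \<open>D\<close> of
  size \<open>t\<close>. A continuum in the level that runs from outside into this set must still have a union
  covering \<open>D\<close>, but now it can do so and miss some arcs: a ray that approaches \<open>D\<close> by swinging back
  and forth over the full circle, always turning around at the same cut point, has as limits of its
  subarcs of size \<open>t\<close> exactly those arcs that do not have the cut point in their interior. If rays
  with a dense set of cut points are available, then for any two different arcs of equal size
  there is a ray whose cut point lies inside one arc and outside the other, and its limits
  separate the two arcs.

  These rays are braided into one path connected graph: at the heights \<open>1 / (n + 1)\<close> the first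
  \<open>n + 1\<close> rays meet in one point, and between two consecutive heights each of them covers the whole
  circle (\<open>swallow_circle\<close>). A continuum outside \<open>D\<close> can thus choose the ray that it follows
  (\<open>separating_ray\<close>).

  The remaining triples of points in a level are handled by paths: an arcwise connected space is
  Wilder, because a path from \<open>x\<close> to \<open>y\<close> can be cut off where it first meets \<open>{y, z}\<close>. Positive Whitney levels
  of path connected continua are path connected (\<open>level_path_connected\<close>), so for \<open>t \<le> \<mu> D\<close> the level
  is the union of two path connected pieces, the subcontinua inside and outside \<open>D\<close>, to which
  \<open>wilder_continuum_if_two_pieces\<close> applies, and for \<open>t > \<mu> D\<close> it is path connected
  (\<open>level_path_connected_above\<close>). That levels are continua at all, and the paths in them, come from
  order arcs (\<open>order_arc\<close>) and from the compactness of the hyperspace (\<open>compact_H\<close>).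
\<close>

section \<open>The hyperspace of subcontinua\<close>

lemma finite_net:
  fixes S :: "'a::metric_space set"
  assumes "compact S" "e > 0"
  shows "\<exists>F. finite F \<and> F \<subseteq> S \<and> S \<subseteq> (\<Union>x\<in>F. ball x e)"
  using seq_compact_imp_totally_bounded[of S] assms unfolding compact_eq_seq_compact_metric by blast

locale metric_continuum =
  fixes S :: "'a::metric_space set"
  assumes compact_S: "compact S" and connected_S: "connected S" and S_ne: "S \<noteq> {}"
begin

abbreviation "X \<equiv> submetric euclidean_metric S"

definition CX :: "'a set set" where
  "CX = {A. A \<subseteq> S \<and> A \<noteq> {} \<and> compact A \<and> connected A}"

definition H :: "'a set topology" where
  "H = mtopology_of (subcontinua X)"

lemma mtopology_X: "mtopology_of X = top_of_set S"
  by (simp add: mtopology_of_submetric)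

lemma continuum_top_of_set:
  "continuum (top_of_set (A :: 'b::metric_space set)) \<longleftrightarrow> A \<noteq> {} \<and> compact A \<and> connected A"
proof -
  have "metrizable_space (top_of_set A)"
    by (simp add: metrizable_space_euclidean metrizable_space_subtopology)
  moreover have "compact_space (top_of_set A) \<longleftrightarrow> compact A"
    using compactin_subspace[of euclidean A] by simp
  moreover have "connected_space (top_of_set A) \<longleftrightarrow> connected A"
    using connectedin_def[of euclidean A] by simp
  ultimately show ?thesis by (simp add: continuum_def)
qed

lemma subcontinuum_X: "subcontinuum (mtopology_of X) A \<longleftrightarrow> A \<in> CX"
proof -
  have "subtopology (top_of_set S) A = top_of_set A" if "A \<subseteq> S"
    using that by (simp add: subtopology_subtopology inf.absorb2)
  then show ?thesis
    unfolding subcontinuum_def mtopology_X CX_def using continuum_top_of_set[of A] by auto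
qed

lemma mspace_subcontinua_X: "mspace (subcontinua X) = CX"
  by (simp add: mspace_subcontinua subcontinuum_X)

lemma CXD:
  assumes "A \<in> CX"
  shows "A \<subseteq> S" "A \<noteq> {}" "compact A" "connected A" "closed A"
  using assms compact_imp_closed by (auto simp: CX_def)

lemma S_in_CX: "S \<in> CX"
  using compact_S connected_S S_ne by (simp add: CX_def)

lemma singleton_in_CX: "x \<in> S \<Longrightarrow> {x} \<in> CX"
  by (simp add: CX_def)

lemma union_in_CX: "A \<in> CX \<Longrightarrow> B \<in> CX \<Longrightarrow> A \<inter> B \<noteq> {} \<Longrightarrow> A \<union> B \<in> CX"
  by (auto simp: CX_def compact_Un connected_Un)

lemma image_in_CX:
  "continuous_on T f \<Longrightarrow> compact T \<Longrightarrow> connected T \<Longrightarrow> T \<noteq> {} \<Longrightarrow> f ` T \<subseteq> S \<Longrightarrow> f ` T \<in> CX"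
  by (auto simp: CX_def compact_continuous_image connected_continuous_image)

abbreviation "hdist \<equiv> hausdorff_dist X"

sublocale HM: Metric_space CX hdist
  using Metric_space_hausdorff_dist[of X] by (simp add: subcontinuum_X)

lemma H_eq: "H = HM.mtopology"
  unfolding H_def mtopology_of_def mspace_subcontinua_X mdist_subcontinua ..

lemma topspace_H [simp]: "topspace H = CX"
  by (simp add: H_eq)

lemma metrizable_H: "metrizable_space H"
  by (simp add: H_eq HM.metrizable_space_mtopology)

lemma hd_eq:
  assumes "A \<in> CX" "B \<in> CX"
  shows "hdist A B = max (SUP a\<in>A. infdist a B) (SUP b\<in>B. infdist b A)"
proof -
  have "compactin (mtopology_of X) A" "compactin (mtopology_of X) B"
    using assms by (auto simp: mtopology_X compactin_subtopology CXD)
  then show ?thesis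
    using CXD[OF assms(1)] CXD[OF assms(2)] by (simp add: hausdorff_dist_def infdist_notempty)
qed

lemma hd_le:
  assumes "A \<in> CX" "B \<in> CX"
    and AB: "\<And>a. a \<in> A \<Longrightarrow> \<exists>b\<in>B. dist a b \<le> e" and BA: "\<And>b. b \<in> B \<Longrightarrow> \<exists>a\<in>A. dist b a \<le> e"
  shows "hdist A B \<le> e"
proof -
  have "infdist a B \<le> e" if "a \<in> A" for a
    using AB[OF that] infdist_le order_trans by blast
  moreover have "infdist b A \<le> e" if "b \<in> B" for b
    using BA[OF that] infdist_le order_trans by blast
  ultimately show ?thesis
    using CXD[OF assms(1)] CXD[OF assms(2)]
    unfolding hd_eq[OF assms(1,2)] by (intro max.boundedI cSUP_least) auto
qed

lemma hd_lessD:
  assumes "A \<in> CX" "B \<in> CX" "hdist A B < e" "a \<in> A"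
  shows "\<exists>b\<in>B. dist a b < e"
proof -
  have "bdd_above ((\<lambda>a. infdist a B) ` A)"
    using CXD[OF assms(1)]
    by (intro bounded_imp_bdd_above compact_imp_bounded compact_continuous_image continuous_intros) auto
  then have "infdist a B \<le> (SUP a\<in>A. infdist a B)"
    using assms by (intro cSUP_upper) auto
  also have "\<dots> < e" using assms(3) by (simp add: hd_eq[OF assms(1,2)])
  finally have "(INF b\<in>B. dist a b) < e"
    using CXD[OF assms(2)] by (simp add: infdist_notempty)
  then show ?thesis
    using CXD[OF assms(2)] by (simp add: cINF_less_iff)
qed

lemma hd_lessD':
  assumes "A \<in> CX" "B \<in> CX" "hdist A B < e" "b \<in> B"
  shows "\<exists>a\<in>A. dist b a < e"
  using hd_lessD[of B A] assms HM.commute by metis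

lemma openin_H_iff:
  "openin H U \<longleftrightarrow> U \<subseteq> CX \<and> (\<forall>A\<in>U. \<exists>r>0. \<forall>B\<in>CX. hdist A B < r \<longrightarrow> B \<in> U)"
  unfolding H_eq HM.openin_mtopology by (fastforce simp: HM.mball_def subset_iff)

text \<open>Together, \<open>openin_hit\<close>, \<open>openin_inside\<close> and \<open>continuous_map_into_H\<close> say that the Hausdorff
  metric induces the Vietoris topology; most later arguments use only this.\<close>

lemma openin_hit:
  assumes "open U"
  shows "openin H {A\<in>CX. A \<inter> U \<noteq> {}}"
  unfolding openin_H_iff
proof (intro conjI ballI)
  fix A assume A: "A \<in> {A\<in>CX. A \<inter> U \<noteq> {}}"
  then obtain a where a: "a \<in> A" "a \<in> U" by blast
  then obtain r where r: "r > 0" "\<And>y. dist a y < r \<Longrightarrow> y \<in> U"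
    using assms by (metis dist_commute open_dist)
  have "B \<inter> U \<noteq> {}" if "B \<in> CX" "hdist A B < r" for B
    using hd_lessD[of A B r a] that A a r by blast
  with r(1) show "\<exists>r>0. \<forall>B\<in>CX. hdist A B < r \<longrightarrow> B \<in> {A\<in>CX. A \<inter> U \<noteq> {}}"
    by (intro exI[of _ r]) auto
qed auto

lemma openin_inside:
  assumes "open U"
  shows "openin H {A\<in>CX. A \<subseteq> U}"
  unfolding openin_H_iff
proof (intro conjI ballI)
  fix A assume A: "A \<in> {A\<in>CX. A \<subseteq> U}"
  then obtain r where r: "r > 0" "(\<Union>x\<in>A. ball x r) \<subseteq> U"
    using compact_subset_open_imp_ball_epsilon_subset[OF CXD(3) assms] by blast
  have "B \<subseteq> U" if "B \<in> CX" "hdist A B < r" for B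
    using hd_lessD'[of A B r] that A r by (force simp: dist_commute)
  with r(1) show "\<exists>r>0. \<forall>B\<in>CX. hdist A B < r \<longrightarrow> B \<in> {A\<in>CX. A \<subseteq> U}"
    by (intro exI[of _ r]) auto
qed auto

lemma closedin_contained:
  assumes "closed B"
  shows "closedin H {A\<in>CX. A \<subseteq> B}"
proof -
  have "CX - {A\<in>CX. A \<subseteq> B} = {A\<in>CX. A \<inter> (- B) \<noteq> {}}" by auto
  then show ?thesis
    using openin_hit[of "- B"] assms by (auto simp: closedin_def)
qed

lemma closedin_mem: "closedin H {A\<in>CX. x \<in> A}"
proof -
  have "CX - {A\<in>CX. x \<in> A} = {A\<in>CX. A \<subseteq> - {x}}" by auto
  then show ?thesis
    using openin_inside[of "- {x}"] by (auto simp: closedin_def)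
qed

lemma closedin_containing: "B \<noteq> {} \<Longrightarrow> closedin H {A\<in>CX. B \<subseteq> A}"
proof -
  assume "B \<noteq> {}"
  moreover have "{A\<in>CX. B \<subseteq> A} = (\<Inter>x\<in>B. {A\<in>CX. x \<in> A})" using \<open>B \<noteq> {}\<close> by auto
  ultimately show ?thesis
    using closedin_mem by auto
qed

text \<open>A value \<open>f z\<close> is covered by finitely many small balls centred on it. Near \<open>z\<close> the values stay
  inside the union of these balls and keep meeting each of them, so they are Hausdorff close to \<open>f z\<close>.\<close>

lemma continuous_map_into_H:
  assumes im: "f \<in> topspace Z \<rightarrow> CX"
    and hit: "\<And>U. open U \<Longrightarrow> openin Z {z\<in>topspace Z. f z \<inter> U \<noteq> {}}"
    and ins: "\<And>U. open U \<Longrightarrow> openin Z {z\<in>topspace Z. f z \<subseteq> U}"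
  shows "continuous_map Z H f"
  unfolding H_eq HM.continuous_map_to_metric
proof (intro ballI allI impI)
  fix z and e :: real
  assume z: "z \<in> topspace Z" and e: "e > 0"
  have fz: "f z \<in> CX" using im z by auto
  have e3: "e/3 > 0" using e by simp
  obtain F where F: "finite F" "F \<subseteq> f z" "f z \<subseteq> (\<Union>x\<in>F. ball x (e/3))"
    using finite_net[OF CXD(3)[OF fz] e3] by blast
  define U where "U = {z'\<in>topspace Z. f z' \<subseteq> (\<Union>x\<in>F. ball x (e/3))} \<inter>
     ((\<Inter>x\<in>F. {z'\<in>topspace Z. f z' \<inter> ball x (e/3) \<noteq> {}}) \<inter> topspace Z)"
  have "openin Z U"
    unfolding U_def using F(1)
    by (intro openin_Int ins openin_INT hit) auto
  moreover have "z \<in> U"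
    using z F e by (force simp: U_def)
  moreover have "f y \<in> HM.mball (f z) e" if "y \<in> U" for y
  proof -
    have y: "y \<in> topspace Z" "f y \<subseteq> (\<Union>x\<in>F. ball x (e/3))" "\<And>x. x \<in> F \<Longrightarrow> f y \<inter> ball x (e/3) \<noteq> {}"
      using that by (auto simp: U_def)
    have fy: "f y \<in> CX" using im y by auto
    have "hdist (f z) (f y) \<le> 2*e/3"
    proof (rule hd_le[OF fz fy])
      fix a assume "a \<in> f z"
      then obtain x where x: "x \<in> F" "dist x a < e/3" using F by auto
      then obtain b where b: "b \<in> f y" "dist x b < e/3" using y(3) by fastforce
      have "dist a b \<le> 2*e/3" using dist_triangle[of a b x] x b by (simp add: dist_commute)
      with b show "\<exists>b\<in>f y. dist a b \<le> 2*e/3" by blast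
    next
      fix b assume "b \<in> f y"
      then obtain x where x: "x \<in> F" "dist x b < e/3" using y(2) by auto
      then have "dist b x \<le> 2*e/3" using e dist_commute[of x b] by linarith
      with x F show "\<exists>a\<in>f z. dist b a \<le> 2*e/3" by blast
    qed
    with e fz fy show ?thesis by simp
  qed
  ultimately show "\<exists>U. openin Z U \<and> z \<in> U \<and> (\<forall>y\<in>U. f y \<in> HM.mball (f z) e)"
    by blast
qed

lemma continuous_map_union:
  assumes f: "continuous_map Z H f" and g: "continuous_map Z H g"
    and meet: "\<And>z. z \<in> topspace Z \<Longrightarrow> f z \<inter> g z \<noteq> {}"
  shows "continuous_map Z H (\<lambda>z. f z \<union> g z)"
proof (rule continuous_map_into_H)
  have fC: "f z \<in> CX" and gC: "g z \<in> CX" if "z \<in> topspace Z" for z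
    using f g that by (auto simp: continuous_map_def)
  show "(\<lambda>z. f z \<union> g z) \<in> topspace Z \<rightarrow> CX"
    using fC gC meet union_in_CX by auto
  fix U :: "'a set" assume U: "open U"
  have "{z \<in> topspace Z. (f z \<union> g z) \<inter> U \<noteq> {}} =
     {z \<in> topspace Z. f z \<in> {A\<in>CX. A \<inter> U \<noteq> {}}} \<union> {z \<in> topspace Z. g z \<in> {A\<in>CX. A \<inter> U \<noteq> {}}}"
    using fC gC by auto
  then show "openin Z {z \<in> topspace Z. (f z \<union> g z) \<inter> U \<noteq> {}}"
    using openin_continuous_map_preimage[OF f openin_hit[OF U]]
      openin_continuous_map_preimage[OF g openin_hit[OF U]] by (simp only: openin_Un)
  have "{z \<in> topspace Z. f z \<union> g z \<subseteq> U} =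
     {z \<in> topspace Z. f z \<in> {A\<in>CX. A \<subseteq> U}} \<inter> {z \<in> topspace Z. g z \<in> {A\<in>CX. A \<subseteq> U}}"
    using fC gC by auto
  then show "openin Z {z \<in> topspace Z. f z \<union> g z \<subseteq> U}"
    using openin_continuous_map_preimage[OF f openin_inside[OF U]]
      openin_continuous_map_preimage[OF g openin_inside[OF U]] by (simp only: openin_Int)
qed

text \<open>The subsets of a finite net of \<open>S\<close> need not be connected, so they cannot serve as a net of the
  hyperspace themselves. Instead, subcontinua are grouped by the net points near them, and one
  representative is picked from each group.\<close>

lemma totally_bounded_H: "HM.mtotally_bounded CX"
  unfolding HM.mtotally_bounded_def
proof (intro allI impI)
  fix e :: real assume e: "e > 0"
  then have e3: "e/3 > 0" by simp
  obtain F where F: "finite F" "S \<subseteq> (\<Union>x\<in>F. ball x (e/3))"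
    using finite_net[OF compact_S e3] by blast
  \<comment> \<open>Net points near \<open>A\<close>; equal values of \<open>p\<close> mean Hausdorff distance at most \<open>2 * e / 3\<close>.\<close>
  define p where "p A = {x\<in>F. A \<inter> ball x (e/3) \<noteq> {}}" for A
  define K where "K = (\<lambda>q. SOME A. A \<in> CX \<and> p A = q) ` (p ` CX)"
  have "finite (p ` CX)"
    by (rule finite_subset[of _ "Pow F"]) (auto simp: p_def F)
  then have "finite K" by (simp add: K_def)
  have rep: "(SOME A'. A' \<in> CX \<and> p A' = p A) \<in> CX \<and> p (SOME A'. A' \<in> CX \<and> p A' = p A) = p A"
    if "A \<in> CX" for A
    by (rule someI_ex) (use that in blast)
  have near: "\<exists>b\<in>B. dist a b \<le> 2*e/3" if "A \<in> CX" "p A = p B" "a \<in> A" for A B a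
  proof -
    have "a \<in> S" using CXD(1)[OF that(1)] that(3) by blast
    then obtain x where x: "x \<in> F" "dist x a < e/3" using F by auto
    then have "x \<in> p A" using that(3) unfolding p_def by fastforce
    then have "x \<in> p B" using that(2) by simp
    then obtain b where b: "b \<in> B" "dist x b < e/3" by (fastforce simp: p_def)
    have "dist a b \<le> 2*e/3" using dist_triangle[of a b x] x b by (simp add: dist_commute)
    with b show ?thesis by blast
  qed
  have "K \<subseteq> CX" using rep by (auto simp: K_def)
  moreover have "CX \<subseteq> (\<Union>A\<in>K. HM.mball A e)"
  proof
    fix A assume A: "A \<in> CX"
    define B where "B = (SOME A'. A' \<in> CX \<and> p A' = p A)"
    have B: "B \<in> CX" "p B = p A" using rep[OF A] by (auto simp: B_def)
    have "hdist B A \<le> 2*e/3" using hd_le[OF B(1) A] near A B by metis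
    then have "A \<in> HM.mball B e" using A B e by simp
    moreover have "B \<in> K" using A by (auto simp: K_def B_def)
    ultimately show "A \<in> (\<Union>A\<in>K. HM.mball A e)" by blast
  qed
  ultimately show "\<exists>K. finite K \<and> K \<subseteq> CX \<and> CX \<subseteq> (\<Union>x\<in>K. HM.mball x e)"
    using \<open>finite K\<close> by blast
qed

text \<open>The limit of a Cauchy sequence of subcontinua is its upper topological limit. Compactness of \<open>S\<close>
  supplies a point of the limit near any given point of a late term. The limit is connected because
  two disjoint open sets separating it would separate all late terms.\<close>

lemma mcomplete_H: "HM.mcomplete"
  unfolding HM.mcomplete_def
proof (intro allI impI)
  fix \<sigma> :: "nat \<Rightarrow> 'a set" assume "HM.MCauchy \<sigma>"
  then have \<sigma>: "\<And>n. \<sigma> n \<in> CX" and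
    Cau: "\<And>e. e > 0 \<Longrightarrow> \<exists>N. \<forall>n n'. N \<le> n \<longrightarrow> N \<le> n' \<longrightarrow> hdist (\<sigma> n) (\<sigma> n') < e"
    by (auto simp: HM.MCauchy_def)
  define L where "L = (\<Inter>n. closure (\<Union>m\<in>{n..}. \<sigma> m))"
  have LS: "L \<subseteq> S"
  proof -
    have "L \<subseteq> closure (\<Union>m\<in>{0..}. \<sigma> m)" unfolding L_def by blast
    also have "\<dots> \<subseteq> S"
      using CXD(1)[OF \<sigma>] compact_imp_closed[OF compact_S] by (intro closure_minimal) auto
    finally show ?thesis .
  qed
  have clL: "closed L" by (auto simp: L_def)
  have cL: "compact L"
    using LS clL compact_S by (metis compact_Int_closed inf.absorb2)
  have near1: "\<exists>l\<in>L. dist x l \<le> e"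
    if N: "\<forall>n n'. N \<le> n \<longrightarrow> N \<le> n' \<longrightarrow> hdist (\<sigma> n) (\<sigma> n') < e" and n: "N \<le> n" "x \<in> \<sigma> n" for x e N n
  proof -
    have "\<exists>y\<in>\<sigma> m. dist x y < e" if "N \<le> m" for m
      using hd_lessD[OF \<sigma>[of n] \<sigma>[of m]] N n that by blast
    then obtain y where y: "\<And>m. N \<le> m \<Longrightarrow> y m \<in> \<sigma> m \<and> dist x (y m) < e" by metis
    have "\<forall>k. y (N + k) \<in> S" using y CXD(1)[OF \<sigma>] by (meson le_add1 subsetD)
    then obtain l r where lr: "l \<in> S" "strict_mono r" "((\<lambda>k. y (N + k)) \<circ> r) \<longlonglongrightarrow> l"
      using compact_S unfolding compact_def by metis
    have "l \<in> closure (\<Union>m\<in>{n..}. \<sigma> m)" for n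
    proof (rule Lim_in_closed_set[OF closed_closure _ _ lr(3)])
      show "\<forall>\<^sub>F k in sequentially. ((\<lambda>k. y (N + k)) \<circ> r) k \<in> closure (\<Union>m\<in>{n..}. \<sigma> m)"
      proof (rule eventually_sequentiallyI[of n])
        fix k assume "n \<le> k"
        then have "n \<le> N + r k" using seq_suble[OF lr(2), of k] by linarith
        then show "((\<lambda>k. y (N + k)) \<circ> r) k \<in> closure (\<Union>m\<in>{n..}. \<sigma> m)"
          using y[of "N + r k"] by (intro closure_subset[THEN subsetD]) auto
      qed
    qed simp
    then have "l \<in> L" by (auto simp: L_def)
    moreover have "dist x l \<le> e"
    proof (rule tendsto_upperbound)
      show "((\<lambda>k. dist x (((\<lambda>k. y (N + k)) \<circ> r) k)) \<longlongrightarrow> dist x l) sequentially"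
        by (intro tendsto_intros lr)
      show "\<forall>\<^sub>F k in sequentially. dist x (((\<lambda>k. y (N + k)) \<circ> r) k) \<le> e"
        using y by (intro always_eventually) (auto intro: less_imp_le)
    qed auto
    ultimately show ?thesis by blast
  qed
  have near2: "\<exists>x\<in>\<sigma> n. dist l x \<le> 2*e"
    if N: "\<forall>n n'. N \<le> n \<longrightarrow> N \<le> n' \<longrightarrow> hdist (\<sigma> n) (\<sigma> n') < e" and n: "N \<le> n" "l \<in> L" and e: "e > 0" for l e N n
  proof -
    have "l \<in> closure (\<Union>m\<in>{N..}. \<sigma> m)" using n by (auto simp: L_def)
    then obtain m y where y: "N \<le> m" "y \<in> \<sigma> m" "dist y l < e"
      using e unfolding closure_approachable by fastforce
    then obtain x where x: "x \<in> \<sigma> n" "dist y x < e" using hd_lessD[OF \<sigma>[of m] \<sigma>[of n]] N n by blast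
    then have "dist l x \<le> 2*e" using dist_triangle[of l x y] y by (simp add: dist_commute)
    with x show ?thesis by blast
  qed
  have Lne: "L \<noteq> {}"
  proof -
    obtain N where N: "\<forall>n n'. N \<le> n \<longrightarrow> N \<le> n' \<longrightarrow> hdist (\<sigma> n) (\<sigma> n') < 1" using Cau[of 1] by auto
    obtain x where "x \<in> \<sigma> N" using CXD(2)[OF \<sigma>] by blast
    then show ?thesis using near1[OF N, of N x] by auto
  qed
  have "connected L"
  proof (rule ccontr)
    assume "\<not> connected L"
    then obtain E1 E2 where E: "closed E1" "closed E2" "E1 \<noteq> {}" "E2 \<noteq> {}" "E1 \<union> E2 = L" "E1 \<inter> E2 = {}"
      unfolding connected_closed_set[OF clL] by blast
    define U1 where "U1 = {x. infdist x E1 < infdist x E2}"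
    define U2 where "U2 = {x. infdist x E2 < infdist x E1}"
    have "open U1" "open U2"
      unfolding U1_def U2_def by (intro open_Collect_less continuous_intros)+
    moreover have "E1 \<subseteq> U1" "E2 \<subseteq> U2"
      using E in_closed_iff_infdist_zero[of E1] in_closed_iff_infdist_zero[of E2]
      by (auto simp: U1_def U2_def less_le infdist_nonneg)
    moreover have "U1 \<inter> U2 = {}" by (auto simp: U1_def U2_def)
    ultimately have U: "open U1" "open U2" "E1 \<subseteq> U1" "E2 \<subseteq> U2" "U1 \<inter> U2 = {}" by auto
    obtain r where r: "r > 0" "(\<Union>x\<in>L. ball x r) \<subseteq> U1 \<union> U2"
      using compact_subset_open_imp_ball_epsilon_subset[OF cL, of "U1 \<union> U2"] U E by blast
    obtain l1 l2 where l: "l1 \<in> E1" "l2 \<in> E2" using E by blast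
    then obtain r1 r2 where r12: "r1 > 0" "ball l1 r1 \<subseteq> U1" "r2 > 0" "ball l2 r2 \<subseteq> U2"
      using U by (meson open_contains_ball subsetD)
    define e where "e = Min {r, r1, r2} / 3"
    have e: "e > 0" "2*e < r" "2*e < r1" "2*e < r2" using r r12 by (auto simp: e_def min_def)
    obtain N where N: "\<forall>n n'. N \<le> n \<longrightarrow> N \<le> n' \<longrightarrow> hdist (\<sigma> n) (\<sigma> n') < e" using Cau[OF e(1)] by auto
    have "\<sigma> N \<subseteq> U1 \<union> U2"
    proof
      fix x assume "x \<in> \<sigma> N"
      then obtain l where "l \<in> L" "dist x l \<le> e" using near1[OF N] by blast
      then have "x \<in> ball l r" using e by (simp add: dist_commute)
      then show "x \<in> U1 \<union> U2" using r \<open>l \<in> L\<close> by blast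
    qed
    moreover obtain x1 where "x1 \<in> \<sigma> N" "dist l1 x1 \<le> 2*e" using near2[OF N _ _ e(1), of N l1] l E by auto
    then have "x1 \<in> \<sigma> N \<inter> U1" using r12 e by (auto simp: subset_iff)
    moreover obtain x2 where "x2 \<in> \<sigma> N" "dist l2 x2 \<le> 2*e" using near2[OF N _ _ e(1), of N l2] l E by auto
    then have "x2 \<in> \<sigma> N \<inter> U2" using r12 e by (auto simp: subset_iff)
    ultimately show False
      using CXD(4)[OF \<sigma>[of N]] U unfolding connected_def by blast
  qed
  then have LC: "L \<in> CX" using LS Lne cL by (simp add: CX_def)
  have "limitin HM.mtopology \<sigma> L sequentially"
    unfolding HM.limitin_metric
  proof (intro conjI allI impI LC)
    fix e :: real assume "e > 0"
    then have e3: "e/3 > 0" by simp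
    obtain N where N: "\<forall>n n'. N \<le> n \<longrightarrow> N \<le> n' \<longrightarrow> hdist (\<sigma> n) (\<sigma> n') < e/3" using Cau[OF e3] by auto
    have "hdist (\<sigma> n) L < e" if "N \<le> n" for n
    proof -
      have "hdist (\<sigma> n) L \<le> 2*(e/3)"
      proof (rule hd_le[OF \<sigma> LC])
        fix a assume "a \<in> \<sigma> n"
        then show "\<exists>b\<in>L. dist a b \<le> 2*(e/3)" using near1[OF N that] e3 by force
      qed (use near2[OF N that _ e3] in auto)
      then show ?thesis using \<open>e > 0\<close> by simp
    qed
    then show "\<forall>\<^sub>F x in sequentially. \<sigma> x \<in> CX \<and> hdist (\<sigma> x) L < e"
      using \<sigma> eventually_sequentially by blast
  qed
  then show "\<exists>x. limitin HM.mtopology \<sigma> x sequentially" ..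
qed

lemma compact_H: "compact_space H"
  unfolding H_eq HM.compact_space_eq_mcomplete_mtotally_bounded
  using mcomplete_H totally_bounded_H by simp

end

section \<open>Order arcs\<close>

locale whitney = metric_continuum S for S :: "'a::metric_space set" +
  fixes \<mu> :: "'a set \<Rightarrow> real"
  assumes whitney_mu: "whitney_map X \<mu>"
begin

lemma continuous_mu: "continuous_map H euclideanreal \<mu>"
  using whitney_mu unfolding whitney_map_def H_def
  by (meson continuous_map_in_subtopology)

lemma mu_singleton: "x \<in> S \<Longrightarrow> \<mu> {x} = 0"
  using whitney_mu by (simp add: whitney_map_def)

lemma mu_strict: "A \<in> CX \<Longrightarrow> B \<in> CX \<Longrightarrow> A \<subset> B \<Longrightarrow> \<mu> A < \<mu> B"
  using whitney_mu by (simp add: whitney_map_def mspace_subcontinua_X)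

lemma mu_mono: "A \<in> CX \<Longrightarrow> B \<in> CX \<Longrightarrow> A \<subseteq> B \<Longrightarrow> \<mu> A \<le> \<mu> B"
  using mu_strict by (metis less_eq_real_def psubsetI)

text \<open>Limits and unions that are known only up to inclusion are identified by their size.\<close>

lemma mu_inj: "A \<in> CX \<Longrightarrow> B \<in> CX \<Longrightarrow> A \<subseteq> B \<Longrightarrow> \<mu> B \<le> \<mu> A \<Longrightarrow> A = B"
  using mu_strict by (metis linorder_not_less psubsetI)

lemma mu_nonneg: "A \<in> CX \<Longrightarrow> 0 \<le> \<mu> A"
  by (metis CXD(1,2) empty_subsetI ex_in_conv insert_subset mu_mono mu_singleton singleton_in_CX subsetD)

lemma mu_le: "A \<in> CX \<Longrightarrow> \<mu> A \<le> \<mu> S"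
  using mu_mono S_in_CX CXD(1) by blast

text \<open>Take a maximal chain of subcontinua between \<open>A\<close> and \<open>B\<close>. It is closed, since being comparable with a
  fixed subcontinuum is a closed condition, and \<open>\<mu>\<close> is injective on it. A gap in the values of \<open>\<mu>\<close>
  would lie between two consecutive members \<open>K0 \<subset> K1\<close>; but some subcontinuum lies strictly between
  them (\<open>intermediate_continuum_exists\<close>, a form of boundary bumping), contrary to maximality. So \<open>\<mu>\<close> maps the
  chain homeomorphically onto an interval, and the order arc is its inverse, parametrized by size.\<close>

lemma order_arc:
  assumes A: "A \<in> CX" and B: "B \<in> CX" and AB: "A \<subseteq> B"
  obtains \<alpha> where "continuous_map (top_of_set {\<mu> A..\<mu> B}) H \<alpha>"
    "\<And>s. s \<in> {\<mu> A..\<mu> B} \<Longrightarrow> \<alpha> s \<in> CX \<and> \<mu> (\<alpha> s) = s \<and> A \<subseteq> \<alpha> s \<and> \<alpha> s \<subseteq> B"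
    "\<And>s s'. s \<in> {\<mu> A..\<mu> B} \<Longrightarrow> s' \<in> {\<mu> A..\<mu> B} \<Longrightarrow> s \<le> s' \<Longrightarrow> \<alpha> s \<subseteq> \<alpha> s'"
proof -
  define F where "F = {K\<in>CX. A \<subseteq> K \<and> K \<subseteq> B}"
  obtain C where C: "subset.maxchain F C" using subset.Hausdorff by blast
  have CF: "C \<subseteq> F" and comp: "\<And>K L. K \<in> C \<Longrightarrow> L \<in> C \<Longrightarrow> K \<subseteq> L \<or> L \<subseteq> K"
    using C unfolding subset.maxchain_def subset.chain_def by auto
  have mx: "K \<in> C" if K: "K \<in> F" "\<And>L. L \<in> C \<Longrightarrow> K \<subseteq> L \<or> L \<subseteq> K" for K
  proof (rule ccontr)
    assume "K \<notin> C"
    then have "C \<subset> insert K C" by blast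
    moreover have "subset.chain F (insert K C)"
      using CF comp K unfolding subset.chain_def by blast
    ultimately show False using C unfolding subset.maxchain_def by blast
  qed
  have ABC: "A \<in> C" "B \<in> C" using mx A B AB CF unfolding F_def by blast+
  have CC: "K \<in> CX" "A \<subseteq> K" "K \<subseteq> B" if "K \<in> C" for K using CF that unfolding F_def by auto
  have "closedin H C"
  proof -
    have "C = (\<Inter>L\<in>C. {K\<in>CX. A \<subseteq> K} \<inter> {K\<in>CX. K \<subseteq> B} \<inter> ({K\<in>CX. K \<subseteq> L} \<union> {K\<in>CX. L \<subseteq> K}))"
      (is "_ = ?R")
    proof
      show "C \<subseteq> ?R" using CC comp by blast
      show "?R \<subseteq> C"
      proof
        fix K assume "K \<in> ?R"
        then have R: "K \<in> CX \<and> A \<subseteq> K \<and> K \<subseteq> B \<and> (K \<subseteq> L \<or> L \<subseteq> K)" if "L \<in> C" for L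
          using that by blast
        show "K \<in> C"
        proof (rule mx)
          show "K \<in> F" using R[OF ABC(1)] by (simp add: F_def)
        qed (use R in blast)
      qed
    qed
    moreover have "closedin H ?R"
      using ABC CXD[OF A] CXD[OF B] CXD[OF CC(1)]
      by (intro closedin_Inter) (auto intro!: closedin_Int closedin_Un closedin_contained closedin_containing)
    ultimately show ?thesis by simp
  qed
  have comC: "compactin H E" if "closedin H E" for E
    using that compact_H closedin_compact_space by blast
  have comp_im: "compact (\<mu> ` E)" if "closedin H E" for E
    using image_compactin[OF comC[OF that] continuous_mu] by simp
  have muord: "K \<subseteq> L" if "K \<in> C" "L \<in> C" "\<mu> K \<le> \<mu> L" for K L
    using comp[OF that(1,2)] mu_inj[of L K] that CC(1) by blast
  have inj: "inj_on \<mu> C"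
    using muord by (intro inj_onI) (metis order_refl subset_antisym)
  have im: "\<mu> ` C = {\<mu> A..\<mu> B}"
  proof
    show "\<mu> ` C \<subseteq> {\<mu> A..\<mu> B}" using CC mu_mono A B by auto
    show "{\<mu> A..\<mu> B} \<subseteq> \<mu> ` C"
    proof
      fix r assume r: "r \<in> {\<mu> A..\<mu> B}"
      show "r \<in> \<mu> ` C"
      proof (rule ccontr)
        assume nr: "r \<notin> \<mu> ` C"
        have "closedin H (C \<inter> {K\<in>topspace H. \<mu> K \<in> {..r}})" "closedin H (C \<inter> {K\<in>topspace H. \<mu> K \<in> {r..}})"
          by (intro closedin_Int \<open>closedin H C\<close> closedin_continuous_map_preimage[OF continuous_mu]; simp)+
        then have "compact (\<mu> ` (C \<inter> {K\<in>topspace H. \<mu> K \<in> {..r}}))"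
          "compact (\<mu> ` (C \<inter> {K\<in>topspace H. \<mu> K \<in> {r..}}))"
          using comp_im by blast+
        moreover have "C \<inter> {K\<in>topspace H. \<mu> K \<in> {..r}} = {K\<in>C. \<mu> K \<le> r}"
          "C \<inter> {K\<in>topspace H. \<mu> K \<in> {r..}} = {K\<in>C. r \<le> \<mu> K}" using CC(1) by auto
        ultimately have cpt: "compact (\<mu> ` {K\<in>C. \<mu> K \<le> r})" "compact (\<mu> ` {K\<in>C. r \<le> \<mu> K})"
          by simp_all
        have "A \<in> {K\<in>C. \<mu> K \<le> r}" "B \<in> {K\<in>C. r \<le> \<mu> K}" using ABC r by auto
        then have ne: "\<mu> ` {K\<in>C. \<mu> K \<le> r} \<noteq> {}" "\<mu> ` {K\<in>C. r \<le> \<mu> K} \<noteq> {}" by blast+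
        obtain K0 where K0: "K0 \<in> C" "\<mu> K0 \<le> r" "\<And>K. K \<in> C \<Longrightarrow> \<mu> K \<le> r \<Longrightarrow> \<mu> K \<le> \<mu> K0"
          using compact_attains_sup[OF cpt(1) ne(1)] by blast
        obtain K1 where K1: "K1 \<in> C" "r \<le> \<mu> K1" "\<And>K. K \<in> C \<Longrightarrow> r \<le> \<mu> K \<Longrightarrow> \<mu> K1 \<le> \<mu> K"
          using compact_attains_inf[OF cpt(2) ne(2)] by blast
        have lt: "\<mu> K0 < r" "r < \<mu> K1" using K0 K1 nr by (metis image_eqI order_le_imp_less_or_eq)+
        then have sub: "K0 \<subset> K1" using muord[OF K0(1) K1(1)] by auto
        have conK1: "connected_space (top_of_set K1)" "compact_space (top_of_set K1)" "Hausdorff_space (top_of_set K1)"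
          using CXD[OF CC(1)[OF K1(1)]] continuum_top_of_set[of K1]
          by (auto simp: continuum_def metrizable_imp_Hausdorff_space)
        obtain D where D: "compactin (top_of_set K1) D" "connectedin (top_of_set K1) D" "K0 \<subset> D" "D \<subset> K1"
        proof (rule intermediate_continuum_exists[of "top_of_set K1" K0 K1])
          show "compactin (top_of_set K1) K0" "connectedin (top_of_set K1) K0" "K0 \<noteq> {}"
            using CXD[OF CC(1)[OF K0(1)]] sub
            by (auto simp: compactin_subtopology connectedin_subtopology)
          show "openin (top_of_set K1) K1" by (metis openin_topspace topspace_euclidean_subtopology)
          show "K0 \<noteq> topspace (top_of_set K1)" "K0 \<subseteq> K1" using sub by auto
        qed (use conK1 compact_imp_locally_compact_space in auto)
        have DC: "D \<in> CX"
          using D CXD[OF CC(1)[OF K1(1)]] CXD[OF CC(1)[OF K0(1)]]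
          by (auto simp: CX_def compactin_subtopology connectedin_subtopology)
        have "D \<in> C"
        proof (rule mx)
          show "D \<in> F" using DC D CC(2)[OF K0(1)] CC(3)[OF K1(1)] by (auto simp: F_def)
          fix L assume L: "L \<in> C"
          show "D \<subseteq> L \<or> L \<subseteq> D"
          proof (cases "\<mu> L \<le> r")
            case True
            then show ?thesis using muord[OF L K0(1)] K0(3)[OF L] D by blast
          next
            case False
            then show ?thesis using muord[OF K1(1) L] K1(3)[OF L] D by auto
          qed
        qed
        moreover have "\<mu> K0 < \<mu> D" "\<mu> D < \<mu> K1" using mu_strict DC D CC(1) K0(1) K1(1) by auto
        ultimately show False using K0(3) K1(3) by (meson linorder_not_less nle_le)
      qed
    qed
  qed
  have topC: "topspace (subtopology H C) = C" using CC(1) by auto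
  have "homeomorphic_map (subtopology H C) (top_of_set {\<mu> A..\<mu> B}) \<mu>"
  proof (rule continuous_imp_homeomorphic_map)
    show "continuous_map (subtopology H C) (top_of_set {\<mu> A..\<mu> B}) \<mu>"
      using continuous_mu im CC(1)
      by (auto simp: continuous_map_in_subtopology continuous_map_from_subtopology)
    show "compact_space (subtopology H C)"
      using comC[OF \<open>closedin H C\<close>] compact_space_subtopology by blast
    show "Hausdorff_space (top_of_set {\<mu> A..\<mu> B})"
      by (simp add: Hausdorff_space_subtopology)
  qed (use topC im inj in auto)
  then obtain \<alpha> where \<alpha>: "homeomorphic_maps (subtopology H C) (top_of_set {\<mu> A..\<mu> B}) \<mu> \<alpha>"
    using homeomorphic_map_maps by blast
  then have cont: "continuous_map (top_of_set {\<mu> A..\<mu> B}) H \<alpha>"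
    and inC: "\<And>s. s \<in> {\<mu> A..\<mu> B} \<Longrightarrow> \<alpha> s \<in> C"
    and mua: "\<And>s. s \<in> {\<mu> A..\<mu> B} \<Longrightarrow> \<mu> (\<alpha> s) = s"
    by (auto simp: homeomorphic_maps_def continuous_map_in_subtopology)
  show ?thesis
    by (rule that[OF cont]) (use inC mua CC muord in auto)
qed

lemma order_arc_from_point:
  assumes "A \<in> CX" "p \<in> A"
  obtains \<alpha> where "continuous_map (top_of_set {0..\<mu> A}) H \<alpha>"
    "\<And>s. s \<in> {0..\<mu> A} \<Longrightarrow> \<alpha> s \<in> CX \<and> \<mu> (\<alpha> s) = s \<and> p \<in> \<alpha> s \<and> \<alpha> s \<subseteq> A"
    "\<And>s s'. s \<in> {0..\<mu> A} \<Longrightarrow> s' \<in> {0..\<mu> A} \<Longrightarrow> s \<le> s' \<Longrightarrow> \<alpha> s \<subseteq> \<alpha> s'"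
proof -
  have p: "p \<in> S" "{p} \<subseteq> A" using assms CXD(1) by auto
  show ?thesis
  proof (rule order_arc[OF singleton_in_CX[OF p(1)] assms(1) p(2)])
    fix \<alpha>
    assume "continuous_map (top_of_set {\<mu> {p}..\<mu> A}) H \<alpha>"
      "\<And>s. s \<in> {\<mu> {p}..\<mu> A} \<Longrightarrow> \<alpha> s \<in> CX \<and> \<mu> (\<alpha> s) = s \<and> {p} \<subseteq> \<alpha> s \<and> \<alpha> s \<subseteq> A"
      "\<And>s s'. s \<in> {\<mu> {p}..\<mu> A} \<Longrightarrow> s' \<in> {\<mu> {p}..\<mu> A} \<Longrightarrow> s \<le> s' \<Longrightarrow> \<alpha> s \<subseteq> \<alpha> s'"
    then show ?thesis
      using that[of \<alpha>] unfolding mu_singleton[OF p(1)] by simp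
  qed
qed

lemma intermediate:
  assumes "A \<in> CX" "B \<in> CX" "A \<subseteq> B" "\<mu> A \<le> t" "t \<le> \<mu> B"
  obtains K where "K \<in> CX" "A \<subseteq> K" "K \<subseteq> B" "\<mu> K = t"
  using order_arc[OF assms(1-3)] assms(4,5) by (metis atLeastAtMost_iff)

text \<open>The part of the Whitney level at \<open>t\<close> that consists of the subcontinua inside \<open>M\<close>; the whole level is
  the case \<open>M = S\<close>.\<close>

definition level :: "'a set \<Rightarrow> real \<Rightarrow> 'a set topology" where
  "level M t = subtopology H {A\<in>CX. A \<subseteq> M \<and> \<mu> A = t}"

lemma topspace_level [simp]: "topspace (level M t) = {A\<in>CX. A \<subseteq> M \<and> \<mu> A = t}"
  by (auto simp: level_def)

lemma path_component_level_mono: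
  "path_component_of (level M t) A B \<Longrightarrow> M \<subseteq> N \<Longrightarrow> path_component_of (level N t) A B"
  unfolding level_def by (erule path_component_of_mono) auto

text \<open>Let \<open>\<alpha>\<close> and \<open>\<beta>\<close> be order arcs from a common point \<open>p\<close> to \<open>A\<close> and \<open>B\<close>. Shrink \<open>A\<close> along \<open>\<alpha>\<close> and make up
  for the loss by growing along \<open>\<beta>\<close>, keeping the size of the union equal to \<open>t\<close>. The amount \<open>b\<close> of
  growth need not be unique, but the union is, because unions with different \<open>b\<close> are nested and of
  equal size. So the path is defined on the quotient \<open>{0..1}\<close> of the compact set \<open>G\<close> of all admissible
  pairs, and it is continuous there although no continuous choice of \<open>b\<close> is made.\<close>

lemma path_of_meet:
  assumes A: "A \<in> CX" "\<mu> A = t" and B: "B \<in> CX" "\<mu> B = t" and meet: "A \<inter> B \<noteq> {}" and M: "A \<union> B \<subseteq> M"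
  shows "path_component_of (level M t) A B"
proof -
  obtain p where p: "p \<in> A" "p \<in> B" using meet by blast
  have pS: "p \<in> S" using p CXD(1)[OF A(1)] by blast
  note [simp] = mu_singleton[OF pS]
  have t0: "0 \<le> t" using mu_nonneg A by blast
  obtain \<alpha> where \<alpha>: "continuous_map (top_of_set {0..t}) H \<alpha>"
    "\<And>s. s \<in> {0..t} \<Longrightarrow> \<alpha> s \<in> CX \<and> \<mu> (\<alpha> s) = s \<and> p \<in> \<alpha> s \<and> \<alpha> s \<subseteq> A"
    using order_arc_from_point[OF A(1) p(1)] A(2) by metis
  obtain \<beta> where \<beta>: "continuous_map (top_of_set {0..t}) H \<beta>"
    "\<And>s. s \<in> {0..t} \<Longrightarrow> \<beta> s \<in> CX \<and> \<mu> (\<beta> s) = s \<and> p \<in> \<beta> s \<and> \<beta> s \<subseteq> B"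
    "\<And>s s'. s \<in> {0..t} \<Longrightarrow> s' \<in> {0..t} \<Longrightarrow> s \<le> s' \<Longrightarrow> \<beta> s \<subseteq> \<beta> s'"
    using order_arc_from_point[OF B(1) p(2)] B(2) by metis
  define Z where "Z = {0..1::real} \<times> {0..t}"
  define \<psi> where "\<psi> z = \<alpha> (t - t * fst z) \<union> \<beta> (snd z)" for z
  have tr: "t - t * r \<in> {0..t}" if "r \<in> {0..1}" for r
    using that t0 by (auto simp: mult_left_le)
  have con\<psi>: "continuous_map (top_of_set Z) H \<psi>"
    unfolding \<psi>_def
  proof (rule continuous_map_union)
    have "continuous_map (top_of_set Z) (top_of_set {0..t}) (\<lambda>z. t - t * fst z)"
      unfolding continuous_map_in_subtopology Z_def
      using tr by (auto intro!: continuous_intros)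
    from continuous_map_compose[OF this \<alpha>(1)]
    show "continuous_map (top_of_set Z) H (\<lambda>z. \<alpha> (t - t * fst z))" by (simp add: o_def)
    have "continuous_map (top_of_set Z) (top_of_set {0..t}) snd"
      unfolding continuous_map_in_subtopology Z_def
      by (auto intro!: continuous_intros)
    from continuous_map_compose[OF this \<beta>(1)]
    show "continuous_map (top_of_set Z) H (\<lambda>z. \<beta> (snd z))" by (simp add: o_def)
    fix z assume "z \<in> topspace (top_of_set Z)"
    then have "p \<in> \<alpha> (t - t * fst z) \<inter> \<beta> (snd z)" using \<alpha>(2) \<beta>(2) tr by (auto simp: Z_def)
    then show "\<alpha> (t - t * fst z) \<inter> \<beta> (snd z) \<noteq> {}" by blast
  qed
  have \<psi>C: "\<psi> z \<in> CX" if "z \<in> Z" for z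
    using con\<psi> that by (auto simp: continuous_map_def)
  define G where "G = {z\<in>Z. \<mu> (\<psi> z) = t}"
  have con\<mu>: "continuous_map (top_of_set Z) euclideanreal (\<mu> \<circ> \<psi>)"
    using continuous_map_compose[OF con\<psi> continuous_mu] .
  have "compact Z" by (auto simp: Z_def intro: compact_Times)
  have "closedin (top_of_set Z) G"
    using closedin_continuous_map_preimage[OF con\<mu>, of "{t}"] by (simp add: G_def)
  then have "compact G" using closedin_compact \<open>compact Z\<close> by blast
  have G: "r \<in> {0..1}" "b \<in> {0..t}" "\<mu> (\<psi> (r, b)) = t" if "(r, b) \<in> G" for r b
    using that by (auto simp: G_def Z_def)
  have ex: "\<exists>b. (r, b) \<in> G" if r: "r \<in> {0..1}" for r
  proof -
    have "continuous_map (top_of_set {0..t}) (top_of_set Z) (\<lambda>b. (r, b))"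
      unfolding continuous_map_in_subtopology Z_def using r
      by (auto intro!: continuous_intros)
    from continuous_map_compose[OF this con\<mu>]
    have cont: "continuous_on {0..t} (\<lambda>b. \<mu> (\<psi> (r, b)))" by (simp add: o_def)
    have z: "(r, 0) \<in> Z" "(r, t) \<in> Z" using r t0 by (auto simp: Z_def)
    have "\<beta> 0 = {p}"
      using mu_inj[OF singleton_in_CX[OF pS], of "\<beta> 0"] \<beta>(2)[of 0] t0 by auto
    then have "\<psi> (r, 0) = \<alpha> (t - t * r)" using \<alpha>(2)[OF tr[OF r]] by (auto simp: \<psi>_def)
    then have lo: "\<mu> (\<psi> (r, 0)) \<le> t" using \<alpha>(2)[OF tr[OF r]] tr[OF r] by simp
    have "\<beta> t \<subseteq> \<psi> (r, t)" by (auto simp: \<psi>_def)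
    then have hi: "t \<le> \<mu> (\<psi> (r, t))" using mu_mono[OF _ \<psi>C[OF z(2)]] \<beta>(2)[of t] t0 by fastforce
    show ?thesis
      using IVT'[OF lo hi t0 cont] r by (auto simp: G_def Z_def)
  qed
  have uniq: "\<psi> (r, b) = \<psi> (r, b')" if "(r, b) \<in> G" "(r, b') \<in> G" for r b b'
  proof -
    have "\<psi> (r, b) = \<psi> (r, b')" if "(r, b) \<in> G" "(r, b') \<in> G" "b \<le> b'" for b b'
    proof (rule mu_inj)
      show "\<psi> (r, b) \<subseteq> \<psi> (r, b')" using \<beta>(3)[of b b'] that G[of r b] G[of r b'] by (auto simp: \<psi>_def)
    qed (use that G[of r b] G[of r b'] \<psi>C in \<open>auto simp: Z_def\<close>)
    then show ?thesis using that by (metis linear)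
  qed
  define \<gamma> where "\<gamma> r = \<psi> (r, SOME b. (r, b) \<in> G)" for r
  have \<gamma>: "\<gamma> r = \<psi> (r, b)" if "(r, b) \<in> G" for r b
    unfolding \<gamma>_def using uniq[OF _ that] someI[of "\<lambda>b. (r, b) \<in> G", OF that] by blast
  have "quotient_map (top_of_set G) (top_of_set {0..1}) fst"
  proof (rule T1_Spaces.continuous_imp_quotient_map)
    show "continuous_map (top_of_set G) (top_of_set {0..1}) fst"
      unfolding continuous_map_in_subtopology by (auto intro!: continuous_intros simp: G_def Z_def)
    show "compact_space (top_of_set G)"
      using \<open>compact G\<close> by (simp add: compact_space_subtopology)
    show "Hausdorff_space (top_of_set {0..1::real})"
      by (simp add: Hausdorff_space_subtopology)
    have "r \<in> fst ` G" if "r \<in> {0..1}" for r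
      using ex[OF that] by (metis fst_conv imageI)
    moreover have "fst ` G \<subseteq> {0..1}" by (auto simp: G_def Z_def)
    ultimately show "fst ` topspace (top_of_set G) = topspace (top_of_set {0..1})"
      by auto
  qed
  moreover have "continuous_map (top_of_set G) H (\<gamma> \<circ> fst)"
  proof (rule continuous_map_eq)
    have "top_of_set G = subtopology (top_of_set Z) G"
      by (simp add: subtopology_subtopology G_def inf.absorb2)
    then show "continuous_map (top_of_set G) H \<psi>"
      using continuous_map_from_subtopology[OF con\<psi>] by metis
  qed (use \<gamma> in auto)
  ultimately have "continuous_map (top_of_set {0..1}) H \<gamma>"
    using continuous_compose_quotient_map by blast
  moreover have "\<gamma> r \<in> CX \<and> \<gamma> r \<subseteq> M \<and> \<mu> (\<gamma> r) = t" if r: "r \<in> {0..1}" for r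
  proof -
    obtain b where b: "(r, b) \<in> G" using ex r by blast
    then have "\<psi> (r, b) \<subseteq> M" using \<alpha>(2)[OF tr[OF r]] \<beta>(2)[OF G(2)[OF b]] M by (auto simp: \<psi>_def)
    then show ?thesis using \<gamma>[OF b] \<psi>C[of "(r, b)"] b by (auto simp: G_def)
  qed
  ultimately have "pathin (level M t) \<gamma>"
    unfolding pathin_def level_def by (auto simp: continuous_map_in_subtopology)
  moreover have "\<gamma> 0 = A"
  proof -
    obtain b where b: "(0, b) \<in> G" using ex[of 0] by auto
    have "\<alpha> t = A" using \<alpha>(2)[of t] t0 A mu_inj[of "\<alpha> t" A] by auto
    then have "A \<subseteq> \<psi> (0, b)" by (auto simp: \<psi>_def)
    then show ?thesis using \<gamma>[OF b] mu_inj[OF A(1) \<psi>C[of "(0, b)"]] b A G(3)[OF b] by (auto simp: G_def)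
  qed
  moreover have "\<gamma> 1 = B"
  proof -
    obtain b where b: "(1, b) \<in> G" using ex[of 1] by auto
    have "\<alpha> 0 = {p}"
      using mu_inj[OF singleton_in_CX[OF pS], of "\<alpha> 0"] \<alpha>(2)[of 0] t0 by auto
    then have "\<psi> (1, b) \<subseteq> B" using \<beta>(2)[OF G(2)[OF b]] p by (auto simp: \<psi>_def)
    then show ?thesis using \<gamma>[OF b] mu_inj[OF \<psi>C[of "(1, b)"] B(1)] b B G(3)[OF b] by (auto simp: G_def)
  qed
  ultimately show ?thesis unfolding path_component_of_def by blast
qed

end


section \<open>Criteria for Wilder continua\<close>

lemma subcontinuum_iff:
  assumes "continuum Y"
  shows "subcontinuum Y C \<longleftrightarrow> C \<noteq> {} \<and> compactin Y C \<and> connectedin Y C"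
  using assms
  by (auto simp: subcontinuum_def continuum_def compactin_subspace connectedin_def
      metrizable_space_subtopology)

lemma subcontinuum_Un:
  assumes "continuum Y" "subcontinuum Y C" "subcontinuum Y D" "C \<inter> D \<noteq> {}"
  shows "subcontinuum Y (C \<union> D)"
  using assms by (auto simp: subcontinuum_iff intro: compactin_Un connectedin_Un)

lemma subcontinuum_path_image:
  assumes "continuum Y" "pathin Y g" "0 \<le> s" "s \<le> 1"
  shows "subcontinuum Y (g ` {0..s})"
proof -
  have g: "continuous_map (top_of_set {0..1}) Y g" using assms(2) by (simp add: pathin_def)
  have "compactin (top_of_set {0..1}) {0..s}" "connectedin (top_of_set {0..1}) {0..s}"
    using assms by (auto simp: compactin_subtopology connectedin_subtopology)
  then show ?thesis
    using image_compactin[OF _ g] connectedin_continuous_map_image[OF g] assms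
    by (auto simp: subcontinuum_iff)
qed

text \<open>The path is stopped at the first time at which it meets \<open>y\<close> or \<open>z\<close>.\<close>

lemma subcontinuum_of_path:
  assumes Y: "continuum Y" and p: "path_component_of (subtopology Y P) x y"
    and ne: "x \<noteq> y" "y \<noteq> z"
  shows "\<exists>C. subcontinuum Y C \<and> x \<in> C \<and> (y \<in> C \<longleftrightarrow> z \<notin> C)"
proof -
  obtain g where g: "pathin Y g" "g ` {0..1} \<subseteq> P" "g 0 = x" "g 1 = y"
    using p by (auto simp: path_component_of_def pathin_subtopology)
  have gc: "continuous_map (top_of_set {0..1}) Y g" using g(1) by (simp add: pathin_def)
  have "Hausdorff_space Y" using Y by (simp add: continuum_def metrizable_imp_Hausdorff_space)
  then have "closedin Y ({y, z} \<inter> topspace Y)"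
    by (intro closedin_Hausdorff_finite) auto
  from closedin_continuous_map_preimage[OF gc this]
  have "closedin (top_of_set {0..1}) {s\<in>{0..1}. g s \<in> {y, z} \<inter> topspace Y}" by simp
  moreover have "{s\<in>{0..1}. g s \<in> {y, z} \<inter> topspace Y} = {s\<in>{0..1}. g s \<in> {y, z}}"
    using gc by (auto simp: continuous_map_def)
  ultimately have "compact {s\<in>{0..1}. g s \<in> {y, z}}"
    using closedin_compact[of "{0..1::real}"] by auto
  moreover have "1 \<in> {s\<in>{0..1}. g s \<in> {y, z}}" using g by auto
  ultimately obtain s where s: "s \<in> {0..1}" "g s \<in> {y, z}" "\<And>r. r \<in> {0..1} \<Longrightarrow> g r \<in> {y, z} \<Longrightarrow> s \<le> r"
    using compact_attains_inf[of "{s\<in>{0..1}. g s \<in> {y, z}}"] by blast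
  have "g r \<in> {y, z} \<Longrightarrow> r = s" if "r \<in> {0..s}" for r
    using s(3)[of r] s(1) that by auto
  then have "y \<in> g ` {0..s} \<longleftrightarrow> z \<notin> g ` {0..s}"
    using s(1,2) ne by (auto simp: image_iff) (metis atLeastAtMost_iff order_refl)+
  moreover have "g 0 \<in> g ` {0..s}" using s(1) by (intro imageI) auto
  ultimately show ?thesis
    using subcontinuum_path_image[OF Y g(1), of s] s(1) g(3) by auto
qed

text \<open>Let \<open>x\<close>, \<open>y\<close>, \<open>z\<close> be different. If \<open>x\<close> shares its piece with \<open>y\<close> or \<open>z\<close>, a path in this piece does. If \<open>x\<close>
  is in \<open>Q\<close> and \<open>y\<close>, \<open>z\<close> are in \<open>P\<close>, boundary bumping enlarges the closed set \<open>Q\<close> to a continuum that still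
  misses \<open>y\<close> and \<open>z\<close> but enters \<open>P\<close>, where a path continues it. The case of \<open>x\<close> in \<open>P\<close> and \<open>y\<close>, \<open>z\<close> in \<open>Q\<close> cannot be
  settled in this way and is the hypothesis \<open>sep\<close>.\<close>

lemma wilder_continuum_if_two_pieces:
  assumes Y: "continuum Y" and un: "topspace Y = P \<union> Q" "P \<inter> Q = {}"
    and Q: "closedin Y Q" "connectedin Y Q"
    and pP: "\<And>x y. x \<in> P \<Longrightarrow> y \<in> P \<Longrightarrow> path_component_of (subtopology Y P) x y"
    and pQ: "\<And>x y. x \<in> Q \<Longrightarrow> y \<in> Q \<Longrightarrow> path_component_of (subtopology Y Q) x y"
    and sep: "\<And>y z. y \<in> Q \<Longrightarrow> z \<in> Q \<Longrightarrow> y \<noteq> z \<Longrightarrow>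
      \<exists>C. subcontinuum Y C \<and> C \<inter> P \<noteq> {} \<and> (y \<in> C \<longleftrightarrow> z \<notin> C)"
  shows "wilder_continuum Y"
  unfolding wilder_continuum_def
proof (intro conjI ballI impI Y)
  fix x y z
  assume xyz: "x \<in> topspace Y" "y \<in> topspace Y" "z \<in> topspace Y" and ne: "x \<noteq> y \<and> x \<noteq> z \<and> y \<noteq> z"
  have path: "\<exists>C. subcontinuum Y C \<and> x \<in> C \<and> (y \<in> C \<longleftrightarrow> z \<notin> C)"
    if "x \<in> R" "y \<in> R \<or> z \<in> R" "\<And>x y. x \<in> R \<Longrightarrow> y \<in> R \<Longrightarrow> path_component_of (subtopology Y R) x y" for R
  proof (cases "y \<in> R")
    case True
    then show ?thesis using subcontinuum_of_path[OF Y that(3)[of x y], of z] that ne by blast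
  next
    case False
    then have "z \<in> R" using that by blast
    then show ?thesis using subcontinuum_of_path[OF Y that(3)[of x z], of y] that ne by blast
  qed
  show "\<exists>C. subcontinuum Y C \<and> x \<in> C \<and> (y \<in> C \<longleftrightarrow> z \<notin> C)"
  proof (cases "x \<in> P")
    case xP: True
    show ?thesis
    proof (cases "y \<in> P \<or> z \<in> P")
      case True
      then show ?thesis using path[OF xP _ pP] by blast
    next
      case False
      then have "y \<in> Q" "z \<in> Q" using un xyz by auto
      then obtain C where C: "subcontinuum Y C" "C \<inter> P \<noteq> {}" "y \<in> C \<longleftrightarrow> z \<notin> C" using sep ne by blast
      then obtain u where u: "u \<in> C" "u \<in> P" by blast
      obtain g where g: "pathin Y g" "g ` {0..1} \<subseteq> P" "g 0 = x" "g 1 = u"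
        using pP[OF xP u(2)] by (auto simp: path_component_of_def pathin_subtopology)
      have "subcontinuum Y (g ` {0..1})" using subcontinuum_path_image[OF Y g(1), of 1] by simp
      moreover have "u \<in> g ` {0..1}" "x \<in> g ` {0..1}" using g by force+
      ultimately have "subcontinuum Y (C \<union> g ` {0..1})" "x \<in> C \<union> g ` {0..1}"
        using subcontinuum_Un[OF Y C(1)] u by blast+
      moreover have "y \<notin> g ` {0..1}" "z \<notin> g ` {0..1}" using g False by blast+
      ultimately show ?thesis using C(3) by (intro exI[of _ "C \<union> g ` {0..1}"]) auto
    qed
  next
    case False
    then have xQ: "x \<in> Q" using un xyz by auto
    show ?thesis
    proof (cases "y \<in> Q \<or> z \<in> Q")
      case True
      then show ?thesis using path[OF xQ _ pQ] by blast
    next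
      case False
      then have yz: "y \<in> P" "z \<in> P" "y \<notin> Q" "z \<notin> Q" using un xyz by auto
      have Ys: "connected_space Y" "compact_space Y" "Hausdorff_space Y"
        using Y by (auto simp: continuum_def metrizable_imp_Hausdorff_space)
      have "openin Y (topspace Y - {y, z})"
        using xyz Ys by (intro openin_diff closedin_Hausdorff_finite) auto
      moreover have "Q \<subseteq> topspace Y - {y, z}" "Q \<noteq> topspace Y" "Q \<noteq> {}"
        using xQ yz un xyz by auto
      moreover have "compactin Y Q" using Q(1) closedin_compact_space[OF Ys(2)] by blast
      ultimately obtain N where N: "compactin Y N" "connectedin Y N" "Q \<subset> N" "N \<subset> topspace Y - {y, z}"
        using intermediate_continuum_exists[OF Ys(1) compact_imp_locally_compact_space[OF Ys(2)] Ys(3) _ Q(2)]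
        by metis
      then obtain u where u: "u \<in> N" "u \<notin> Q" by blast
      have uP: "u \<in> P" using u N un by blast
      have Nc: "subcontinuum Y N" using N u Y by (auto simp: subcontinuum_iff)
      have "u \<noteq> y" using u N by blast
      then obtain C where C: "subcontinuum Y C" "u \<in> C" "y \<in> C \<longleftrightarrow> z \<notin> C"
        using subcontinuum_of_path[OF Y pP[OF uP yz(1)], of z] ne by blast
      have "subcontinuum Y (N \<union> C)" using subcontinuum_Un[OF Y Nc C(1)] u C by blast
      moreover have "x \<in> N \<union> C" using N xQ by blast
      moreover have "y \<notin> N" "z \<notin> N" using N by blast+
      ultimately show ?thesis using C(3) by (intro exI[of _ "N \<union> C"]) auto
    qed
  qed
qed

lemma wilder_continuum_if_path_connected:
  assumes Y: "continuum Y"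
    and p: "\<And>x y. x \<in> topspace Y \<Longrightarrow> y \<in> topspace Y \<Longrightarrow> path_component_of Y x y"
  shows "wilder_continuum Y"
  by (rule wilder_continuum_if_two_pieces[OF Y, of "topspace Y" "{}"]) (use p in auto)

section \<open>Connectedness of Whitney levels\<close>

context whitney
begin

text \<open>A point \<open>x\<close> outside the union has distance at least \<open>1 / Suc n\<close> from each member, with \<open>n\<close> depending on
  the member; compactness of \<open>E\<close> makes \<open>n\<close> uniform.\<close>

lemma closed_Union_H:
  assumes "closedin H E"
  shows "closed (\<Union>E)"
  unfolding closed_def open_contains_ball
proof
  fix x assume x: "x \<in> - \<Union>E"
  have EC: "E \<subseteq> CX" using closedin_subset[OF assms] by simp
  define U where "U n = {A\<in>CX. A \<subseteq> - cball x (inverse (Suc n))}" for n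
  have "compactin H E" using assms compact_H closedin_compact_space by blast
  moreover have "\<forall>V\<in>range U. openin H V"
    unfolding U_def by (auto intro!: openin_inside)
  moreover have "E \<subseteq> \<Union>(range U)"
  proof
    fix A assume A: "A \<in> E"
    then have "open (- A)" "x \<in> - A" using x EC CXD(5) by auto
    then obtain e where e: "e > 0" "cball x e \<subseteq> - A" using open_contains_cball by blast
    then obtain n where "inverse (Suc n) < e" using reals_Archimedean by blast
    then have "cball x (inverse (Suc n)) \<subseteq> cball x e" by (simp add: subset_cball)
    then have "A \<in> U n" using e A EC by (auto simp: U_def)
    then show "A \<in> \<Union>(range U)" by blast
  qed
  ultimately obtain \<F> where F: "finite \<F>" "\<F> \<subseteq> range U" "E \<subseteq> \<Union>\<F>"
    unfolding compactin_def by meson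
  then obtain I where I: "finite I" "\<F> = U ` I" by (metis finite_subset_image)
  define N where "N = Max (insert 0 I)"
  have "ball x (inverse (Suc N)) \<subseteq> - \<Union>E"
  proof -
    have "A \<subseteq> - cball x (inverse (Suc N))" if A: "A \<in> E" for A
    proof -
      obtain n where n: "n \<in> I" "A \<in> U n" using F(3) A I by auto
      then have "n \<le> N" using I by (simp add: N_def)
      then have "cball x (inverse (Suc N)) \<subseteq> cball x (inverse (Suc n))"
        by (intro subset_cball) (simp add: le_imp_inverse_le)
      then show ?thesis using n by (auto simp: U_def)
    qed
    then show ?thesis using ball_subset_cball[of x "inverse (Suc N)"] by blast
  qed
  then show "\<exists>e>0. ball x e \<subseteq> - \<Union>E" by (metis inverse_positive_iff_positive of_nat_0_less_iff zero_less_Suc)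
qed

lemma closedin_level: "closedin H {A\<in>CX. A \<subseteq> S \<and> \<mu> A = t}"
proof -
  have "{A\<in>CX. A \<subseteq> S \<and> \<mu> A = t} = {A\<in>topspace H. \<mu> A \<in> {t}}" using CXD(1) by auto
  then show ?thesis using closedin_continuous_map_preimage[OF continuous_mu, of "{t}"] by simp
qed

text \<open>If a level were the union of two disjoint closed parts, the unions of the two parts would be
  closed and cover the connected set \<open>S\<close>, so two members from different parts would meet; but such
  members are joined by a path (\<open>path_of_meet\<close>).\<close>

lemma continuum_level:
  assumes t: "0 \<le> t" "t \<le> \<mu> S"
  shows "continuum (level S t)"
proof -
  have through: "\<exists>A\<in>topspace (level S t). x \<in> A" if x: "x \<in> S" for x
    using intermediate[OF singleton_in_CX[OF x] S_in_CX, of t] t x mu_singleton[OF x] CXD(1)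
    by (auto) (metis insert_subset)
  have "connected_space (level S t)"
    unfolding connected_space_clopen_in
  proof (intro allI impI)
    fix T assume T: "openin (level S t) T \<and> closedin (level S t) T"
    show "T = {} \<or> T = topspace (level S t)"
    proof (rule ccontr)
      assume nt: "\<not> ?thesis"
      define T' where "T' = topspace (level S t) - T"
      have Ts: "T \<subseteq> topspace (level S t)" using T openin_subset by blast
      have "closedin (level S t) T'"
        unfolding T'_def using T by (intro closedin_diff closedin_topspace) blast
      then have "closedin H T" "closedin H T'"
        using T closedin_level unfolding level_def by (meson closedin_trans_full)+
      then have cl: "closed (\<Union>T)" "closed (\<Union>T')" by (auto intro: closed_Union_H)
      have "S \<subseteq> \<Union>T \<union> \<Union>T'"
      proof
        fix x assume "x \<in> S"
        then obtain A where "A \<in> topspace (level S t)" "x \<in> A" using through by blast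
        then show "x \<in> \<Union>T \<union> \<Union>T'" unfolding T'_def by blast
      qed
      moreover have TS: "\<Union>T \<subseteq> S" "\<Union>T' \<subseteq> S" using Ts by (auto simp: T'_def)
      moreover have ne: "\<Union>T \<inter> S \<noteq> {}" "\<Union>T' \<inter> S \<noteq> {}"
      proof -
        have "T \<noteq> {}" "T' \<noteq> {}" using nt Ts by (auto simp: T'_def)
        moreover have "\<Union>T \<noteq> {}" if "T \<noteq> {}" "T \<subseteq> topspace (level S t)" for T
          using that CXD(2) by fastforce
        ultimately have "\<Union>T \<noteq> {}" "\<Union>T' \<noteq> {}" using Ts by (auto simp: T'_def)
        then show "\<Union>T \<inter> S \<noteq> {}" "\<Union>T' \<inter> S \<noteq> {}" using TS by blast+
      qed
      ultimately have "\<Union>T \<inter> \<Union>T' \<inter> S \<noteq> {}"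
        using connected_closedD[OF connected_S _ _ cl] by blast
      then obtain p A B where p: "A \<in> T" "B \<in> T'" "p \<in> A" "p \<in> B" by blast
      have "path_component_of (level S t) A B"
      proof (rule path_of_meet)
        have "A \<in> topspace (level S t)" "B \<in> topspace (level S t)" using p(1,2) Ts by (auto simp only: T'_def)
        then show "A \<in> CX" "\<mu> A = t" "B \<in> CX" "\<mu> B = t" "A \<union> B \<subseteq> S" by simp_all
      qed (use p(3,4) in blast)
      then have "connected_component_of (level S t) A B"
        by (simp add: path_imp_connected_component_of)
      then obtain Q where Q: "connectedin (level S t) Q" "A \<in> Q" "B \<in> Q"
        by (auto simp: connected_component_of_def)
      then have "Q \<subseteq> T \<or> disjnt Q T" using connectedin_clopen_cases T by blast
      then show False using Q p by (auto simp: T'_def disjnt_def)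
    qed
  qed
  moreover have "topspace (level S t) \<noteq> {}" using through S_ne by blast
  moreover have "compact_space (level S t)"
    using closedin_level closedin_compact_space[OF compact_H] unfolding level_def
    by (meson compact_space_subtopology)
  moreover have "metrizable_space (level S t)"
    unfolding level_def by (simp add: metrizable_H metrizable_space_subtopology)
  ultimately show ?thesis by (simp add: continuum_def)
qed

text \<open>Move along a path \<open>g\<close> in \<open>M\<close> from a point of \<open>A\<close> to a point of \<open>B\<close>. For each \<open>s\<close>, all members of the level
  through \<open>g s\<close> lie in one path component. Since \<open>t > 0\<close>, a short piece of \<open>g\<close> around \<open>s\<close> has size at most
  \<open>t\<close> and so is contained in a single member of the level. Thus the path component is locally constant
  in \<open>s\<close>.\<close>

lemma level_path_connected:
  assumes M: "M \<in> CX" "path_connected M" and t: "0 < t"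
    and A: "A \<in> CX" "A \<subseteq> M" "\<mu> A = t" and B: "B \<in> CX" "B \<subseteq> M" "\<mu> B = t"
  shows "path_component_of (level M t) A B"
proof -
  obtain a b where ab: "a \<in> A" "b \<in> B" using CXD(2)[OF A(1)] CXD(2)[OF B(1)] by blast
  then obtain g where g: "path g" "path_image g \<subseteq> M" "pathstart g = a" "pathfinish g = b"
    using M(2) A B unfolding path_connected_def by (meson subsetD)
  have gc: "continuous_on {0..1} g" using g(1) by (simp add: path_def)
  have gM: "g s \<in> M" if "s \<in> {0..1}" for s using g(2) that by (auto simp: path_image_def)
  have tM: "t \<le> \<mu> M" using mu_mono[OF A(1) M(1)] A by simp
  have grow: "\<exists>L. L \<in> topspace (level M t) \<and> N \<subseteq> L" if "N \<in> CX" "N \<subseteq> M" "\<mu> N \<le> t" for N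
    using intermediate[OF that(1) M(1) that(2,3) tM] by auto
  have "\<exists>L. L \<in> topspace (level M t) \<and> g s \<in> L" if s: "s \<in> {0..1}" for s
  proof -
    have "g s \<in> S" using gM[OF s] CXD(1)[OF M(1)] by blast
    then show ?thesis using grow[of "{g s}"] gM[OF s] t by (simp add: singleton_in_CX mu_singleton)
  qed
  then obtain K where K: "\<And>s. s \<in> {0..1} \<Longrightarrow> K s \<in> topspace (level M t) \<and> g s \<in> K s" by metis
  have meet: "path_component_of (level M t) L L'"
    if "L \<in> topspace (level M t)" "L' \<in> topspace (level M t)" "x \<in> L" "x \<in> L'" for L L' x
    using that by (intro path_of_meet) auto
  have "path_component_of (level M t) (K 0) (K 1)"
  proof (rule connected_equivalence_relation[where R = "\<lambda>s r. path_component_of (level M t) (K s) (K r)" and S = "{0..1::real}"])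
    fix s :: real assume s: "s \<in> {0..1}"
    have gS: "g s \<in> S" using gM[OF s] CXD(1)[OF M(1)] by blast
    have "openin H {L\<in>topspace H. \<mu> L \<in> {..<t}}"
      using openin_continuous_map_preimage[OF continuous_mu, of "{..<t}"] by simp
    moreover have "{g s} \<in> {L\<in>topspace H. \<mu> L \<in> {..<t}}"
      using gS t by (simp add: singleton_in_CX mu_singleton)
    ultimately obtain r where r: "r > 0" "\<And>L. L \<in> CX \<Longrightarrow> hdist {g s} L < r \<Longrightarrow> \<mu> L < t"
      unfolding openin_H_iff by (smt (verit) lessThan_iff mem_Collect_eq)
    obtain d where d: "d > 0" "\<And>s'. s' \<in> {0..1} \<Longrightarrow> dist s' s < d \<Longrightarrow> dist (g s') (g s) < r/2"
      using gc s r(1) unfolding continuous_on_iff by (metis half_gt_zero)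
    define I where "I = {0..1} \<inter> cball s (d/2)"
    have I: "I \<subseteq> {0..1}" "s \<in> I" "compact I" "connected I"
      using s d(1) by (auto simp: I_def compact_Int convex_Int convex_connected)
    have Isub: "dist (g s') (g s) < r/2" if "s' \<in> I" for s'
      using d that by (auto simp: I_def dist_commute)
    define N where "N = g ` I"
    have N: "N \<in> CX" "N \<subseteq> M"
    proof -
      show "N \<subseteq> M" using gM I(1) by (auto simp: N_def)
      then show "N \<in> CX"
        using image_in_CX[OF continuous_on_subset[OF gc I(1)] I(3,4)] I(2) CXD(1)[OF M(1)]
        unfolding N_def by blast
    qed
    have "hdist {g s} N \<le> r/2"
    proof (rule hd_le[OF singleton_in_CX[OF gS] N(1)])
      fix a assume "a \<in> {g s}"
      then show "\<exists>b\<in>N. dist a b \<le> r/2" using I(2) r(1) by (auto simp: N_def intro!: bexI[of _ s])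
    next
      fix b assume "b \<in> N"
      then show "\<exists>a\<in>{g s}. dist b a \<le> r/2" using Isub by (auto simp: N_def intro: less_imp_le)
    qed
    then have "\<mu> N \<le> t" using r N by (intro less_imp_le r(2)) auto
    then obtain L where L: "L \<in> topspace (level M t)" "N \<subseteq> L" using grow N by blast
    have "path_component_of (level M t) (K s) (K s')" if "s' \<in> I" for s'
    proof -
      have "g s \<in> L" "g s' \<in> L" using L(2) I(2) that by (auto simp: N_def)
      moreover have "K s' \<in> topspace (level M t) \<and> g s' \<in> K s'" using K I(1) that by blast
      ultimately have m: "g s \<in> L" "g s' \<in> L" "K s' \<in> topspace (level M t)" "g s' \<in> K s'" by blast+
      have "path_component_of (level M t) (K s) L"
        by (rule meet[OF _ L(1) _ m(1)]) (use K[OF s] in blast)+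
      moreover have "path_component_of (level M t) L (K s')"
        by (rule meet[OF L(1) m(3) m(2) m(4)])
      ultimately show ?thesis by (rule path_component_of_trans)
    qed
    moreover have "openin (top_of_set {0..1}) ({0..1} \<inter> ball s (d/2))" by (simp add: openin_open_Int)
    moreover have "s \<in> {0..1} \<inter> ball s (d/2)" using s d by auto
    moreover have "{0..1} \<inter> ball s (d/2) \<subseteq> I" by (auto simp: I_def)
    ultimately show "\<exists>T. openin (top_of_set {0..1}) T \<and> s \<in> T \<and>
        (\<forall>r\<in>T. path_component_of (level M t) (K s) (K r))"
      by (intro exI[of _ "{0..1} \<inter> ball s (d/2)"]) blast
  qed (auto intro: path_component_of_sym path_component_of_trans)
  moreover have "path_component_of (level M t) A (K 0)"
    by (rule meet[of A "K 0" a]) (use A ab g(3) K[of 0] in \<open>simp_all add: pathstart_def\<close>)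
  moreover have "path_component_of (level M t) (K 1) B"
    by (rule meet[of "K 1" B b]) (use B ab g(4) K[of 1] in \<open>simp_all add: pathfinish_def\<close>)
  ultimately show ?thesis by (meson path_component_of_trans)
qed

end

section \<open>Continua wrapped around a core\<close>

context metric_continuum
begin

definition path_exhausted :: "'a set \<Rightarrow> bool" where
  "path_exhausted \<rho> \<longleftrightarrow> (\<forall>K. compact K \<and> K \<noteq> {} \<and> K \<subseteq> \<rho> \<longrightarrow>
     (\<exists>N\<in>CX. K \<subseteq> N \<and> N \<subseteq> \<rho> \<and> path_connected N))"

lemma not_nested_neighbourhoods:
  assumes "K \<in> CX" "L \<in> CX" "\<not> L \<subseteq> K"
  obtains U V where "openin H U" "openin H V" "K \<in> U" "L \<in> V" "\<And>A B. A \<in> U \<Longrightarrow> B \<in> V \<Longrightarrow> \<not> B \<subseteq> A"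
proof -
  obtain a where a: "a \<in> L" "a \<notin> K" using assms by blast
  moreover have "open (- K)" using CXD(5)[OF assms(1)] by blast
  ultimately obtain e where e: "e > 0" "cball a e \<subseteq> - K" by (meson ComplI open_contains_cball)
  show ?thesis
  proof (rule that)
    show "openin H {A\<in>CX. A \<subseteq> - cball a e}" "openin H {A\<in>CX. A \<inter> ball a e \<noteq> {}}"
      by (auto intro!: openin_inside openin_hit)
    show "K \<in> {A\<in>CX. A \<subseteq> - cball a e}" using assms e by auto
    show "L \<in> {A\<in>CX. A \<inter> ball a e \<noteq> {}}" using assms e a by (auto intro!: exI[of _ a])
    show "\<not> B \<subseteq> A" if "A \<in> {A\<in>CX. A \<subseteq> - cball a e}" "B \<in> {A\<in>CX. A \<inter> ball a e \<noteq> {}}" for A B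
      using that ball_subset_cball[of a e] by blast
  qed
qed

lemma subset_if_limits:
  assumes \<sigma>: "limitin H \<sigma> K sequentially" and \<tau>: "limitin H \<tau> L sequentially"
    and fr: "\<exists>\<^sub>F n in sequentially. \<tau> n \<subseteq> \<sigma> n"
  shows "L \<subseteq> K"
proof (rule ccontr)
  assume n: "\<not> L \<subseteq> K"
  have "K \<in> CX" "L \<in> CX" using limitin_topspace[OF \<sigma>] limitin_topspace[OF \<tau>] by auto
  then obtain U V where UV: "openin H U" "openin H V" "K \<in> U" "L \<in> V" "\<And>A B. A \<in> U \<Longrightarrow> B \<in> V \<Longrightarrow> \<not> B \<subseteq> A"
    using not_nested_neighbourhoods n by metis
  have "\<forall>\<^sub>F n in sequentially. \<sigma> n \<in> U" "\<forall>\<^sub>F n in sequentially. \<tau> n \<in> V"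
    using \<sigma> \<tau> UV by (auto simp: limitin_def)
  then have "\<forall>\<^sub>F n in sequentially. \<not> \<tau> n \<subseteq> \<sigma> n"
    by eventually_elim (use UV(5) in blast)
  then show False using fr by (simp add: frequently_def)
qed

end

context whitney
begin

text \<open>A ray is not compact, so \<open>level_path_connected\<close> does not apply to it directly,
  but any two members of the level lie in a common path connected subcontinuum.\<close>

lemma path_in_exhausted:
  assumes ex: "path_exhausted \<rho>" and t: "0 < t"
    and A: "A \<in> topspace (level \<rho> t)" and B: "B \<in> topspace (level \<rho> t)"
  shows "path_component_of (level \<rho> t) A B"
proof -
  have AB: "A \<in> CX" "B \<in> CX" "A \<subseteq> \<rho>" "B \<subseteq> \<rho>" "\<mu> A = t" "\<mu> B = t" using A B by auto
  then have "compact (A \<union> B)" "A \<union> B \<noteq> {}" "A \<union> B \<subseteq> \<rho>" using CXD by auto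
  then obtain N where "N \<in> CX" "A \<union> B \<subseteq> N" "N \<subseteq> \<rho>" "path_connected N"
    using ex unfolding path_exhausted_def by meson
  then show ?thesis
    using level_path_connected[of N t A B] path_component_level_mono[of N t A B \<rho>] t AB by auto
qed

text \<open>Approximants of \<open>K\<close> can be given the exact size of \<open>K\<close>. Adjust each term of a sequence converging to \<open>K\<close>; a
  limit \<open>L\<close> of the adjusted terms is comparable with \<open>K\<close> and has the same size, so \<open>L = K\<close>.\<close>

lemma closure_of_adjusted:
  assumes F: "\<F> \<subseteq> CX" and K: "K \<in> H closure_of \<F>" "\<mu> K = t"
    and adj: "\<And>J. J \<in> \<F> \<Longrightarrow> \<exists>J'\<in>\<F>. \<mu> J' = t \<and> (J \<subseteq> J' \<or> J' \<subseteq> J)"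
  shows "K \<in> H closure_of {A\<in>\<F>. \<mu> A = t}"
proof -
  obtain \<sigma> where \<sigma>: "range \<sigma> \<subseteq> \<F>" "limitin H \<sigma> K sequentially"
    using K(1) unfolding H_eq HM.closure_of_sequentially by auto
  then have "\<forall>n. \<exists>J'. J' \<in> \<F> \<and> \<mu> J' = t \<and> (\<sigma> n \<subseteq> J' \<or> J' \<subseteq> \<sigma> n)"
    using adj by (metis rangeI subsetD)
  then obtain \<tau> where \<tau>: "\<And>n. \<tau> n \<in> \<F> \<and> \<mu> (\<tau> n) = t \<and> (\<sigma> n \<subseteq> \<tau> n \<or> \<tau> n \<subseteq> \<sigma> n)" by metis
  have "range \<tau> \<subseteq> CX" using \<tau> F by auto
  then obtain L r where L: "L \<in> CX" "strict_mono r" "limitin H (\<tau> \<circ> r) L sequentially"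
    using compact_H unfolding H_eq HM.compact_space_sequentially by metis
  have sr: "limitin H (\<sigma> \<circ> r) K sequentially" using limitin_subsequence[OF L(2) \<sigma>(2)] .
  have Lin: "L \<in> H closure_of {A\<in>\<F>. \<mu> A = t}"
    using L \<tau> F unfolding H_eq HM.closure_of_sequentially
    by (auto intro!: exI[of _ "\<tau> \<circ> r"])
  have KC: "K \<in> CX" using limitin_topspace[OF \<sigma>(2)] by simp
  have "H closure_of {A\<in>\<F>. \<mu> A = t} \<subseteq> {A\<in>CX. A \<subseteq> S \<and> \<mu> A = t}"
    by (rule closure_of_minimal[OF _ closedin_level]) (use F CXD(1) in auto)
  then have muL: "\<mu> L = t" using Lin by auto
  have "\<exists>\<^sub>F n in sequentially. (\<sigma> \<circ> r) n \<subseteq> (\<tau> \<circ> r) n \<or> (\<tau> \<circ> r) n \<subseteq> (\<sigma> \<circ> r) n"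
    by (rule eventually_frequently) (use \<tau> in auto)
  then have "K \<subseteq> L \<or> L \<subseteq> K"
    unfolding frequently_disj_iff using subset_if_limits[OF L(3) sr] subset_if_limits[OF sr L(3)] by blast
  then have "K = L" using mu_inj[OF KC L(1)] mu_inj[OF L(1) KC] muL K(2) by auto
  then show ?thesis using Lin by simp
qed

end

text \<open>The properties of the circle \<open>D\<close> and the graph around it that make the levels Wilder. They do not
  refer to a Whitney map; in \<open>rays\<close>, the subcontinua of all sizes inside \<open>\<rho>\<close> are used, and
  \<open>closure_of_adjusted\<close> restricts to those of a given size. That \<open>D\<close> itself is a limit ensures that \<open>\<rho>\<close>
  contains subcontinua of every size below \<open>\<mu> D\<close>.\<close>

locale wrapped_continuum = metric_continuum S for S :: "'a::metric_space set" +
  fixes D :: "'a set"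
  assumes D: "D \<in> CX" "path_connected D"
    and swallow: "\<And>M. M \<in> CX \<Longrightarrow> M \<inter> D \<noteq> {} \<Longrightarrow> \<not> M \<subseteq> D \<Longrightarrow> D \<subseteq> M"
    and exhaust: "path_exhausted (S - D)"
    and rays: "\<And>K1 K2. K1 \<in> CX \<Longrightarrow> K2 \<in> CX \<Longrightarrow> K1 \<subseteq> D \<Longrightarrow> K2 \<subseteq> D \<Longrightarrow> K1 \<noteq> D \<Longrightarrow> \<not> K1 \<subseteq> K2 \<Longrightarrow>
       \<nexists>x. K1 = {x} \<Longrightarrow>
       \<exists>\<rho>\<subseteq>S - D. path_exhausted \<rho> \<and>
         D \<in> H closure_of {A\<in>CX. A \<subseteq> \<rho>} \<and> K2 \<in> H closure_of {A\<in>CX. A \<subseteq> \<rho>} \<and>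
         K1 \<notin> H closure_of {A\<in>CX. A \<subseteq> \<rho>}"

locale wrapped_whitney = wrapped_continuum S D + whitney S \<mu> for S :: "'a::metric_space set" and D \<mu>
begin

lemma path_in_complement:
  "0 < t \<Longrightarrow> A \<in> topspace (level (S - D) t) \<Longrightarrow> B \<in> topspace (level (S - D) t) \<Longrightarrow> path_component_of (level (S - D) t) A B"
  by (rule path_in_exhausted[OF exhaust])

text \<open>A member of a level above \<open>\<mu> D\<close> either avoids \<open>D\<close> or contains it. Two members of the first kind are
  joined outside \<open>D\<close>, and two of the second kind meet. To pass from one kind to the other, choose a
  point \<open>p\<close> outside \<open>D\<close> in a member \<open>B\<close> containing \<open>D\<close>, and go through a member that contains \<open>p\<close> and
  avoids \<open>D\<close>.\<close>

lemma level_path_connected_above: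
  assumes t: "\<mu> D < t" and A: "A \<in> topspace (level S t)" and B: "B \<in> topspace (level S t)"
  shows "path_component_of (level S t) A B"
proof -
  have t0: "0 < t" using mu_nonneg[OF D(1)] t by linarith
  have dich: "A \<subseteq> S - D \<or> D \<subset> A" if "A \<in> topspace (level S t)" for A
  proof -
    have A: "A \<in> CX" "\<mu> A = t" "A \<subseteq> S" using that by auto
    then have "\<not> A \<subseteq> D" using mu_mono[OF A(1) D(1)] t by auto
    then show ?thesis using swallow[OF A(1)] A by blast
  qed
  have mixed: "path_component_of (level S t) A B"
    if A: "A \<in> topspace (level S t)" "A \<subseteq> S - D" and B: "B \<in> topspace (level S t)" "D \<subset> B" for A B
  proof -
    have AB: "A \<in> CX" "B \<in> CX" "\<mu> A = t" "\<mu> B = t" "B \<subseteq> S" using A B by auto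
    obtain p where p: "p \<in> B" "p \<notin> D" using B by blast
    then have pS: "p \<in> S" using AB by blast
    have "compact (insert p A)" "insert p A \<subseteq> S - D" using CXD(3)[OF AB(1)] A p pS by auto
    then obtain N where N: "N \<in> CX" "insert p A \<subseteq> N" "N \<subseteq> S - D" "path_connected N"
      using exhaust unfolding path_exhausted_def by (metis insert_not_empty)
    have "t \<le> \<mu> N" using mu_mono[OF AB(1) N(1)] N AB by auto
    then obtain A' where A': "A' \<in> CX" "{p} \<subseteq> A'" "A' \<subseteq> N" "\<mu> A' = t"
      using intermediate[OF singleton_in_CX[OF pS] N(1), of t] N t0 mu_singleton[OF pS]
      by (metis insert_subset less_imp_le empty_subsetI)
    have NS: "N \<subseteq> S" using N by blast
    have "path_component_of (level N t) A A'"
      using level_path_connected[OF N(1,4) t0 AB(1) _ AB(3) A'(1,3,4)] N(2) by blast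
    then have "path_component_of (level S t) A A'" using path_component_level_mono NS by blast
    moreover have "path_component_of (level S t) A' B"
      using path_of_meet[OF A'(1,4) AB(2,4), of S] A' p NS AB by blast
    ultimately show ?thesis by (rule path_component_of_trans)
  qed
  show ?thesis
  proof (cases "A \<subseteq> S - D")
    case True
    show ?thesis
    proof (cases "B \<subseteq> S - D")
      case True
      then have "path_component_of (level (S - D) t) A B"
        using A B \<open>A \<subseteq> S - D\<close> by (intro path_in_complement t0) auto
      then show ?thesis using path_component_level_mono by blast
    next
      case False
      then show ?thesis using mixed[OF A True B] dich[OF B] by blast
    qed
  next
    case False
    then have DA: "D \<subset> A" using dich[OF A] by blast
    show ?thesis
    proof (cases "B \<subseteq> S - D")
      case True
      then show ?thesis using path_component_of_sym[OF mixed[OF B True A DA]] by blast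
    next
      case False
      then have "D \<subset> B" using dich[OF B] by blast
      then have "A \<inter> B \<noteq> {}" using DA CXD(2)[OF D(1)] by blast
      then show ?thesis using A B by (intro path_of_meet) auto
    qed
  qed
qed

text \<open>The separating subcontinuum of the level is the closure of the set of its members inside the
  ray \<open>\<rho>\<close> that accumulates at \<open>K2\<close> but not at \<open>K1\<close>.\<close>

lemma separating_subcontinuum:
  assumes t: "0 < t" "t < \<mu> D"
    and K1: "K1 \<in> topspace (level D t)" and K2: "K2 \<in> topspace (level D t)" and ne: "K1 \<noteq> K2"
  shows "\<exists>C. subcontinuum (level S t) C \<and> C \<inter> topspace (level (S - D) t) \<noteq> {} \<and> K2 \<in> C \<and> K1 \<notin> C"
proof -
  have K: "K1 \<in> CX" "K1 \<subseteq> D" "\<mu> K1 = t" "K2 \<in> CX" "K2 \<subseteq> D" "\<mu> K2 = t" using K1 K2 by auto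
  have nsub: "\<not> K1 \<subseteq> K2" using mu_inj[OF K(1,4)] K ne by auto
  have nD: "K1 \<noteq> D" using K t by auto
  have nd: "\<nexists>x. K1 = {x}"
    using mu_singleton K(3) CXD(1)[OF K(1)] t by auto
  obtain \<rho> where r: "\<rho> \<subseteq> S - D" "path_exhausted \<rho>"
    "D \<in> H closure_of {A\<in>CX. A \<subseteq> \<rho>}" "K2 \<in> H closure_of {A\<in>CX. A \<subseteq> \<rho>}"
    "K1 \<notin> H closure_of {A\<in>CX. A \<subseteq> \<rho>}"
    using rays[OF K(1,4,2,5) nD nsub nd] by blast
  define V where "V = {L\<in>topspace H. \<mu> L \<in> {t<..}}"
  have V: "D \<in> V" "openin H V"
    unfolding V_def using openin_continuous_map_preimage[OF continuous_mu, of "{t<..}"] D t by simp_all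
  have "\<forall>T. D \<in> T \<and> openin H T \<longrightarrow> (\<exists>E. E \<in> {A\<in>CX. A \<subseteq> \<rho>} \<and> E \<in> T)"
    using r(3) unfolding in_closure_of by (rule conjunct2)
  with V have "\<exists>E. E \<in> {A\<in>CX. A \<subseteq> \<rho>} \<and> E \<in> V" by metis
  then obtain E where E: "E \<in> CX" "E \<subseteq> \<rho>" "t < \<mu> E" by (auto simp: V_def)
  define T where "T = {A\<in>{A\<in>CX. A \<subseteq> \<rho>}. \<mu> A = t}"
  have TL: "T = topspace (level \<rho> t)" by (auto simp: T_def)
  have K2T: "K2 \<in> H closure_of T"
    unfolding T_def
  proof (rule closure_of_adjusted[OF _ r(4) K(6)])
    fix J assume "J \<in> {A\<in>CX. A \<subseteq> \<rho>}"
    then have J: "J \<in> CX" "J \<subseteq> \<rho>" by auto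
    show "\<exists>J'\<in>{A\<in>CX. A \<subseteq> \<rho>}. \<mu> J' = t \<and> (J \<subseteq> J' \<or> J' \<subseteq> J)"
    proof (cases "\<mu> J \<le> t")
      case True
      have "compact (J \<union> E)" "J \<union> E \<noteq> {}" "J \<union> E \<subseteq> \<rho>" using CXD J E by auto
      then obtain N where N: "N \<in> CX" "J \<union> E \<subseteq> N" "N \<subseteq> \<rho>"
        using r(2) unfolding path_exhausted_def by meson
      have "t \<le> \<mu> N" using mu_mono[OF E(1) N(1)] N E by auto
      then obtain J' where "J' \<in> CX" "J \<subseteq> J'" "J' \<subseteq> N" "\<mu> J' = t"
        using intermediate[OF J(1) N(1) _ True] N by blast
      then show ?thesis using N by blast
    next
      case False
      obtain p where p: "p \<in> J" using CXD(2)[OF J(1)] by blast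
      then have pS: "p \<in> S" using CXD(1)[OF J(1)] by blast
      obtain J' where "J' \<in> CX" "{p} \<subseteq> J'" "J' \<subseteq> J" "\<mu> J' = t"
        using intermediate[OF singleton_in_CX[OF pS] J(1), of t] p False t mu_singleton[OF pS]
        by (metis empty_subsetI insert_subset less_imp_le linorder_not_le)
      then show ?thesis using J by blast
    qed
  qed auto
  have K1T: "K1 \<notin> H closure_of T"
    using r(5) closure_of_mono[of T "{A\<in>CX. A \<subseteq> \<rho>}" H] by (auto simp: T_def)
  have subT: "H closure_of T \<subseteq> {A\<in>CX. A \<subseteq> S \<and> \<mu> A = t}"
    by (rule closure_of_minimal[OF _ closedin_level]) (use CXD(1) in \<open>auto simp: T_def\<close>)
  have TT: "T \<subseteq> H closure_of T" by (rule closure_of_subset) (auto simp: T_def)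
  have "connected_space (level \<rho> t)"
    unfolding connected_space_iff_connected_component
    using path_imp_connected_component_of[OF path_in_exhausted[OF r(2) t(1)]] by blast
  then have "connectedin H T"
    unfolding connectedin_def TL level_def by (auto simp: Collect_conj_eq)
  then have conn: "connectedin H (H closure_of T)" by (rule connectedin_closure_of)
  have comp: "compactin H (H closure_of T)"
    by (rule closedin_compact_space[OF compact_H closedin_closure_of])
  have Y: "continuum (level S t)"
    using continuum_level t mu_le[OF D(1)] by auto
  have "subcontinuum (level S t) (H closure_of T)"
    using K2T subT conn comp unfolding subcontinuum_iff[OF Y]
    by (auto simp: level_def compactin_subtopology connectedin_subtopology)
  moreover have "H closure_of T \<inter> topspace (level (S - D) t) \<noteq> {}"
  proof -
    have "T \<noteq> {}" using K2T by auto
    then obtain A where "A \<in> T" by blast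
    then have "A \<in> topspace (level (S - D) t)" using r(1) by (auto simp: T_def)
    then show ?thesis using TT \<open>A \<in> T\<close> by blast
  qed
  ultimately show ?thesis using K1T K2T by blast
qed

theorem wilder_level:
  assumes t: "0 < t" "t \<le> \<mu> S"
  shows "wilder_continuum (level S t)"
proof (cases "\<mu> D < t")
  case True
  then show ?thesis
    using wilder_continuum_if_path_connected[OF continuum_level[OF less_imp_le[OF t(1)] t(2)]]
      level_path_connected_above[OF True] by blast
next
  case False
  define P where "P = {A\<in>CX. A \<subseteq> S - D \<and> \<mu> A = t}"
  define Q where "Q = {A\<in>CX. A \<subseteq> D \<and> \<mu> A = t}"
  have DS: "D \<subseteq> S" using CXD(1)[OF D(1)] .
  have subP: "subtopology (level S t) P = level (S - D) t" and subQ: "subtopology (level S t) Q = level D t"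
    unfolding level_def subtopology_subtopology P_def Q_def using DS
    by (auto intro!: arg_cong[of _ _ "subtopology H"])
  have pQ: "path_component_of (level D t) A B" if "A \<in> Q" "B \<in> Q" for A B
    using level_path_connected[OF D t(1)] that by (auto simp: Q_def)
  show ?thesis
  proof (rule wilder_continuum_if_two_pieces[of "level S t" P Q])
    show "continuum (level S t)" using continuum_level t by auto
    show "topspace (level S t) = P \<union> Q"
    proof
      show "topspace (level S t) \<subseteq> P \<union> Q"
      proof
        fix A assume "A \<in> topspace (level S t)"
        then have A: "A \<in> CX" "A \<subseteq> S" "\<mu> A = t" by auto
        have "\<not> D \<subset> A" using mu_strict[OF D(1) A(1)] A(3) False by auto
        then show "A \<in> P \<union> Q" using swallow[OF A(1)] A by (auto simp: P_def Q_def)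
      qed
    qed (use DS in \<open>auto simp: P_def Q_def\<close>)
    show "P \<inter> Q = {}" using CXD(2) by (auto simp: P_def Q_def)
    have "{A\<in>CX. A \<subseteq> D} \<inter> topspace (level S t) = Q" using DS by (auto simp: Q_def)
    then show "closedin (level S t) Q"
      using closedin_contained[OF CXD(5)[OF D(1)]] DS
      by (metis (no_types, lifting) level_def closedin_subtopology topspace_level)
    have "connected_space (level D t)"
      unfolding connected_space_iff_connected_component
      using path_imp_connected_component_of[OF pQ] by (auto simp: Q_def)
    then show "connectedin (level S t) Q"
      unfolding connectedin_def subQ using DS by (auto simp: Q_def)
    show "path_component_of (subtopology (level S t) P) A B" if "A \<in> P" "B \<in> P" for A B
      unfolding subP using that by (intro path_in_complement t(1)) (auto simp: P_def)
    show "path_component_of (subtopology (level S t) Q) A B" if "A \<in> Q" "B \<in> Q" for A B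
      unfolding subQ using pQ that .
    fix y z assume yz: "y \<in> Q" "z \<in> Q" "y \<noteq> z"
    have "y = D \<and> z = D" if "t = \<mu> D"
      using mu_inj[OF _ D(1), of y] mu_inj[OF _ D(1), of z] yz(1,2) that by (simp add: Q_def)
    then have "t \<noteq> \<mu> D" using yz(3) by blast
    then have "t < \<mu> D" using False by simp
    then show "\<exists>C. subcontinuum (level S t) C \<and> C \<inter> P \<noteq> {} \<and> (y \<in> C \<longleftrightarrow> z \<notin> C)"
      using separating_subcontinuum[OF t(1), of y z] yz by (auto simp: P_def Q_def)
  qed
qed

end

section \<open>The braid\<close>

text \<open>Points of \<open>\<complex> \<times> \<real> \<times> \<real>\<close> embedded in the sequence space. The complex coordinate is the projection to
  the circle, \<open>u\<close> is the height above it, and \<open>v\<close> keeps different strands apart.\<close>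

definition pt :: "complex \<Rightarrow> real \<Rightarrow> real \<Rightarrow> nat \<Rightarrow> real" where
  "pt z u v = (\<lambda>k. if k = 0 then Re z else if k = 1 then Im z else if k = 2 then u else if k = 3 then v else 0)"

definition circ :: "(nat \<Rightarrow> real) \<Rightarrow> complex" where "circ x = Complex (x 0) (x 1)"
definition ht :: "(nat \<Rightarrow> real) \<Rightarrow> real" where "ht x = x 2"
definition offset :: "(nat \<Rightarrow> real) \<Rightarrow> real" where "offset x = x 3"

lemma pt_simps [simp]: "circ (pt z u v) = z" "ht (pt z u v) = u" "offset (pt z u v) = v"
  by (simp_all add: pt_def circ_def ht_def offset_def)

lemma continuous_on_pt [continuous_intros]:
  assumes "continuous_on T a" "continuous_on T b" "continuous_on T c"
  shows "continuous_on T (\<lambda>x. pt (a x) (b x) (c x))"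
  unfolding pt_def
proof (rule continuous_on_coordinatewise_then_product)
  fix i :: nat
  show "continuous_on T (\<lambda>x. if i = 0 then Re (a x) else if i = 1 then Im (a x) else if i = 2 then b x
      else if i = 3 then c x else 0)"
    using continuous_on_Re[OF assms(1)] continuous_on_Im[OF assms(1)] assms(2,3)
    by (cases "i = 0"; cases "i = 1"; cases "i = 2"; cases "i = 3") simp_all
qed

lemma continuous_coords: "continuous_on T circ" "continuous_on T ht" "continuous_on T offset"
proof -
  have c: "continuous_on T (\<lambda>x::nat\<Rightarrow>real. x i)" for i
    by (rule continuous_on_subset[OF continuous_on_product_coordinates]) simp
  show "continuous_on T ht" "continuous_on T offset" unfolding ht_def offset_def by (rule c)+
  have ceq: "circ = (\<lambda>x. of_real (x 0) + \<i> * of_real (x 1))"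
    by (auto simp: circ_def complex_eq_iff)
  show "continuous_on T circ" by (subst ceq) (intro continuous_intros c)
qed

lemma near_circle:
  assumes "r > 0"
  shows "\<exists>d>0. \<forall>z u v. norm z = 1 \<longrightarrow> 0 \<le> v \<longrightarrow> v \<le> u \<longrightarrow> u < d \<longrightarrow> dist (pt z u v) (pt z 0 0) < r"
proof -
  define B where "B = (sphere 0 1 \<times> {0..1} \<times> {0..1} :: (complex \<times> real \<times> real) set)"
  have "compact B" unfolding B_def by (intro compact_Times) auto
  moreover have "continuous_on B (\<lambda>x. pt (fst x) (fst (snd x)) (snd (snd x)))"
    by (intro continuous_intros)
  ultimately have "uniformly_continuous_on B (\<lambda>x. pt (fst x) (fst (snd x)) (snd (snd x)))"
    by (rule compact_uniformly_continuous[rotated])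
  then obtain d where d: "d > 0"
    "\<And>x y. x \<in> B \<Longrightarrow> y \<in> B \<Longrightarrow> dist y x < d \<Longrightarrow>
      dist (pt (fst y) (fst (snd y)) (snd (snd y))) (pt (fst x) (fst (snd x)) (snd (snd x))) < r"
    unfolding uniformly_continuous_on_def using assms by meson
  have "dist (pt z u v) (pt z 0 0) < r" if "norm z = 1" "0 \<le> v" "v \<le> u" "u < min 1 (d/2)" for z u v
  proof -
    have "dist (z, u, v) (z, 0, 0) \<le> \<bar>u\<bar> + \<bar>v\<bar>"
      by (simp add: dist_Pair_Pair sqrt_sum_squares_le_sum_abs)
    also have "\<dots> < d" using that by auto
    finally show ?thesis
      using d(2)[of "(z, 0, 0)" "(z, u, v)"] that by (auto simp: B_def)
  qed
  then show ?thesis using d(1) by (intro exI[of _ "min 1 (d/2)"]) auto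
qed

definition shift :: "nat \<Rightarrow> real" where "shift j = real_of_rat (from_nat j)"

lemma shift_dense: "x < y \<Longrightarrow> \<exists>j. x < shift j \<and> shift j < y"
  using of_rat_dense[of x y] surj_from_nat unfolding shift_def by (metis surj_def)

text \<open>For \<open>y\<close> from \<open>-1\<close> to \<open>1\<close> the phase runs once around the circle. Both ends are the cut point of the
  \<open>j\<close>-th ray. The offset by \<open>sin (shift j)\<close> moves the cut point, and it is chosen such that
  \<open>phase j (sin (2 * pi * s + shift j))\<close> equals \<open>1\<close> at all integers \<open>s\<close>, where the rays are to meet.\<close>

definition phase :: "nat \<Rightarrow> real \<Rightarrow> complex" where
  "phase j y = cis (pi * (y - sin (shift j)))"

definition top_height :: "nat \<Rightarrow> real" where "top_height j = 1 / (real j + 1)"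

text \<open>With \<open>s = 1 / u\<close> as time, the strand swings over the circle with period \<open>1\<close> while its height tends
  to \<open>0\<close>. The last coordinate vanishes exactly at the integer times, and it is different for
  different \<open>j\<close> at all other times. The \<open>j\<close>-th ray begins at time \<open>j + 1\<close>, so that at each time only
  finitely many rays are present.\<close>

definition strand :: "nat \<Rightarrow> real \<Rightarrow> nat \<Rightarrow> real" where
  "strand j u = pt (phase j (sin (2 * pi / u + shift j))) u (u * (sin (pi / u))\<^sup>2 / (real j + 1))"

definition ray :: "nat \<Rightarrow> (nat \<Rightarrow> real) set" where
  "ray j = strand j ` {0<..top_height j}"

definition circle :: "(nat \<Rightarrow> real) set" where
  "circle = (\<lambda>z. pt z 0 0) ` sphere 0 1"

definition braid :: "(nat \<Rightarrow> real) set" where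
  "braid = circle \<union> (\<Union>j. ray j)"

definition upper :: "nat \<Rightarrow> (nat \<Rightarrow> real) set" where
  "upper n = (\<Union>j\<in>{..n}. strand j ` {top_height n..top_height j})"

lemma norm_phase [simp]: "norm (phase j y) = 1"
  by (simp add: phase_def)

lemma continuous_on_phase [continuous_intros]:
  "continuous_on T f \<Longrightarrow> continuous_on T (\<lambda>x. phase j (f x))"
  unfolding phase_def by (intro continuous_intros)

lemma top_height_pos [simp]: "0 < top_height j"
  by (simp add: top_height_def)

lemma top_height_le_1: "top_height j \<le> 1"
  by (simp add: top_height_def)

lemma top_height_le_iff: "top_height n \<le> top_height j \<longleftrightarrow> j \<le> n"
  by (simp add: top_height_def field_simps)

lemma strand_simps [simp]:
  "ht (strand j u) = u" "circ (strand j u) = phase j (sin (2 * pi / u + shift j))"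
  "offset (strand j u) = u * (sin (pi / u))\<^sup>2 / (real j + 1)"
  by (simp_all add: strand_def)

lemma offset_strand_bounds:
  assumes "u > 0" shows "0 \<le> offset (strand j u)" "offset (strand j u) \<le> u"
proof -
  have "(sin (pi / u))\<^sup>2 \<le> 1" by (simp add: abs_square_le_1)
  then have "u * (sin (pi / u))\<^sup>2 \<le> u * (real j + 1)"
    using assms by (intro mult_left_mono) auto
  then show "offset (strand j u) \<le> u" by (simp add: field_simps)
qed (use assms in simp)

lemma continuous_on_strand: "0 \<notin> T \<Longrightarrow> continuous_on T (strand j)"
  unfolding strand_def by (intro continuous_intros) auto

lemma strand_at_top_height: "strand j (top_height n) = pt 1 (top_height n) 0"
proof -
  have "sin (2 * pi * (real n + 1) + shift j) = sin (shift j)"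
    using sin_cos_eq_iff[of "2 * pi * (real n + 1) + shift j" "shift j"]
    by (metis add.commute of_int_of_nat_eq of_nat_Suc)
  moreover have "sin (pi * (real n + 1)) = 0"
    using sin_npi2[of "Suc n"] by (simp add: algebra_simps)
  ultimately show ?thesis
    by (simp add: strand_def top_height_def phase_def)
qed

lemma circle_pos: "x \<in> circle \<Longrightarrow> ht x = 0"
  by (auto simp: circle_def)

lemma ray_pos: "x \<in> ray j \<Longrightarrow> 0 < ht x \<and> ht x \<le> top_height j \<and> x = strand j (ht x)"
  by (auto simp: ray_def)

lemma strand_in_ray: "0 < u \<Longrightarrow> u \<le> top_height j \<Longrightarrow> strand j u \<in> ray j"
  by (auto simp: ray_def)

lemma braid_cases:
  assumes "x \<in> braid"
  obtains "x \<in> circle" "ht x = 0" | j where "0 < ht x" "ht x \<le> top_height j" "x = strand j (ht x)" "x \<in> ray j"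
  using assms circle_pos ray_pos unfolding braid_def by blast

lemma braid_minus_circle: "braid - circle = (\<Union>j. ray j)"
  using circle_pos ray_pos by (fastforce simp: braid_def)

lemma braid_coords:
  assumes "x \<in> braid"
  shows "norm (circ x) = 1" "0 \<le> offset x" "offset x \<le> ht x" "0 \<le> ht x" "ht x \<le> 1" "x = pt (circ x) (ht x) (offset x)"
proof -
  have "norm (circ x) = 1 \<and> 0 \<le> offset x \<and> offset x \<le> ht x \<and> 0 \<le> ht x \<and> ht x \<le> 1 \<and> x = pt (circ x) (ht x) (offset x)"
    using assms
  proof (cases rule: braid_cases)
    case 1
    then show ?thesis by (auto simp: circle_def)
  next
    case (2 j)
    then obtain u where u: "x = strand j u" "0 < u" "u \<le> top_height j" by metis
    have "x = pt (circ x) (ht x) (offset x)" by (simp add: u(1)) (simp add: strand_def)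
    then show ?thesis
      using u offset_strand_bounds[OF u(2), of j] top_height_le_1[of j] by (auto simp del: strand_simps(3))
  qed
  then show "norm (circ x) = 1" "0 \<le> offset x" "offset x \<le> ht x" "0 \<le> ht x" "ht x \<le> 1" "x = pt (circ x) (ht x) (offset x)"
    by auto
qed

text \<open>The height controls the distance to the projection to the circle uniformly over all rays. This
  makes low lifts of a subset of the circle converge to it.\<close>

lemma near_circle_braid:
  assumes "r > 0"
  shows "\<exists>d>0. \<forall>x\<in>braid. ht x < d \<longrightarrow> dist x (pt (circ x) 0 0) < r"
  using near_circle[OF assms] braid_coords by metis

lemma upper_eq: "upper n = {x\<in>braid. top_height n \<le> ht x}"
proof
  show "upper n \<subseteq> {x\<in>braid. top_height n \<le> ht x}"
  proof
    fix x assume "x \<in> upper n"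
    then obtain j u where "x = strand j u" "top_height n \<le> u" "u \<le> top_height j" by (auto simp: upper_def)
    then show "x \<in> {x\<in>braid. top_height n \<le> ht x}"
      using strand_in_ray[of u j] less_le_trans[OF top_height_pos[of n]] by (auto simp: braid_def)
  qed
  show "{x\<in>braid. top_height n \<le> ht x} \<subseteq> upper n"
  proof
    fix x assume x: "x \<in> {x\<in>braid. top_height n \<le> ht x}"
    then have "x \<in> braid" by simp
    then show "x \<in> upper n"
    proof (cases rule: braid_cases)
      case 1
      then show ?thesis using x top_height_pos[of n] by auto
    next
      case (2 j)
      then have "j \<le> n" using x top_height_le_iff[of n j] by auto
      moreover have "strand j (ht x) \<in> strand j ` {top_height n..top_height j}" using 2 x by auto
      ultimately show ?thesis using 2(3) unfolding upper_def by (metis UN_I atMost_iff)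
    qed
  qed
qed

lemma compact_strand: "0 < a \<Longrightarrow> compact (strand j ` {a..b})"
  by (intro compact_continuous_image continuous_on_strand) auto

lemma path_connected_strand: "0 < a \<Longrightarrow> path_connected (strand j ` {a..b})"
  by (intro path_connected_continuous_image continuous_on_strand convex_imp_path_connected) auto

lemma compact_upper: "compact (upper n)"
  unfolding upper_def by (intro compact_UN compact_strand) auto

lemma path_connected_upper: "path_connected (upper n)"
proof -
  let ?v = "pt 1 (top_height n) 0"
  have "path_component (upper n) ?v x" if x: "x \<in> upper n" for x
  proof -
    obtain j where j: "j \<le> n" "x \<in> strand j ` {top_height n..top_height j}" using x unfolding upper_def by blast
    have "?v \<in> strand j ` {top_height n..top_height j}"
      using j(1) strand_at_top_height[of j n] top_height_le_iff[of n j]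
      by (metis atLeastAtMost_iff imageI order_refl)
    then have "path_component (strand j ` {top_height n..top_height j}) ?v x"
      using path_connected_strand[OF top_height_pos] j(2) unfolding path_connected_component by blast
    then show ?thesis
      by (rule path_component_of_subset[rotated]) (use j in \<open>auto simp: upper_def\<close>)
  qed
  then show ?thesis
    unfolding path_connected_component by (meson path_component_sym path_component_trans)
qed

lemma small_top_height: "0 < e \<Longrightarrow> \<exists>n. top_height n < e"
  using reals_Archimedean[of e] by (simp add: top_height_def inverse_eq_divide add.commute)

text \<open>A limit point of positive height is a limit of points of some \<open>upper n\<close>, a compact set. A limit
  point of height \<open>0\<close> has last coordinate \<open>0\<close>, since that is bounded by the height.\<close>

lemma closed_braid: "closed braid"
  unfolding closed_sequential_limits
proof (intro allI impI)
  fix x l assume xl: "(\<forall>n. x n \<in> braid) \<and> x \<longlonglongrightarrow> l"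
  have lim: "(\<lambda>n. f (x n)) \<longlonglongrightarrow> f l" if "continuous_on UNIV f" for f :: "(nat \<Rightarrow> real) \<Rightarrow> 'z::topological_space"
    using continuous_on_tendsto_compose[OF that] xl by auto
  have ge: "0 \<le> ht l"
    by (rule LIMSEQ_le_const[OF lim[OF continuous_coords(2)]]) (use xl braid_coords in blast)
  show "l \<in> braid"
  proof (cases "ht l = 0")
    case True
    have "(\<lambda>n. 1) \<longlonglongrightarrow> norm (circ l)"
      using tendsto_norm[OF lim[OF continuous_coords(1)]] xl braid_coords(1) by simp
    then have "norm (circ l) = 1" by (simp add: LIMSEQ_const_iff)
    moreover have "0 \<le> offset l"
      by (rule LIMSEQ_le_const[OF lim[OF continuous_coords(3)]]) (use xl braid_coords in blast)
    moreover have "offset l \<le> ht l"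
      by (rule LIMSEQ_le[OF lim[OF continuous_coords(3)] lim[OF continuous_coords(2)]]) (use xl braid_coords in blast)
    moreover have "l = pt (circ l) (ht l) (offset l)"
    proof -
      have "(\<lambda>n. pt (circ (x n)) (ht (x n)) (offset (x n))) \<longlonglongrightarrow> pt (circ l) (ht l) (offset l)"
        by (intro lim continuous_on_pt continuous_coords)
      then have "x \<longlonglongrightarrow> pt (circ l) (ht l) (offset l)" using xl braid_coords(6) by simp
      then show ?thesis using xl LIMSEQ_unique by blast
    qed
    ultimately have "l = pt (circ l) 0 0 \<and> circ l \<in> sphere 0 1" using True by auto
    then show ?thesis unfolding braid_def circle_def by blast
  next
    case False
    then have "0 < ht l" using ge by simp
    then obtain n where n: "top_height n < ht l" using small_top_height by blast
    have "\<forall>\<^sub>F k in sequentially. top_height n < ht (x k)"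
      using order_tendstoD(1)[OF lim[OF continuous_coords(2)] n] .
    then have "\<forall>\<^sub>F k in sequentially. x k \<in> upper n"
      by eventually_elim (use xl in \<open>auto simp: upper_eq\<close>)
    then have "l \<in> upper n"
      using Lim_in_closed_set[OF compact_imp_closed[OF compact_upper], of x n sequentially l] xl by simp
    then show ?thesis by (simp add: upper_eq)
  qed
qed

lemma compact_braid: "compact braid"
proof -
  have "compact ((\<lambda>x. pt (fst x) (fst (snd x)) (snd (snd x))) ` (sphere 0 1 \<times> {0..1} \<times> {0..1}))" (is "compact ?B")
    by (intro compact_continuous_image compact_Times continuous_intros) auto
  moreover have "braid \<subseteq> ?B"
  proof
    fix x assume x: "x \<in> braid"
    have "x = (\<lambda>x. pt (fst x) (fst (snd x)) (snd (snd x))) (circ x, ht x, offset x)"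
      using braid_coords(6)[OF x] by simp
    then show "x \<in> ?B"
      by (rule image_eqI) (use braid_coords[OF x] in auto)
  qed
  then have "?B \<inter> braid = braid" by blast
  ultimately show ?thesis using compact_Int_closed[OF _ closed_braid, of ?B] by simp
qed

text \<open>The sine takes the required value at some time \<open>s0\<close>, and full periods move \<open>s0\<close> into the given
  interval.\<close>

lemma phase_hit:
  assumes "norm z = 1"
  shows "\<exists>s\<in>{a..a+1}. phase j (sin (2 * pi * s + shift j)) = z"
proof -
  obtain \<theta> where \<theta>: "z = cis \<theta>" using assms cis_Arg[of z]
    by (metis norm_eq_zero sgn_div_norm div_by_1 inverse_1 one_neq_zero scaleR_one)
  \<comment> \<open>The sine value \<open>y\<close> for the angle \<open>\<theta>\<close>, brought into the interval from \<open>-1\<close> to \<open>1\<close> by full turns.\<close>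
  define k where "k = \<lfloor>(\<theta> / pi + sin (shift j) + 1) / 2\<rfloor>"
  define y where "y = \<theta> / pi + sin (shift j) - 2 * real_of_int k"
  have "real_of_int k \<le> (\<theta> / pi + sin (shift j) + 1) / 2" "(\<theta> / pi + sin (shift j) + 1) / 2 < real_of_int k + 1"
    unfolding k_def by linarith+
  then have y: "- 1 \<le> y" "y \<le> 1"
    unfolding y_def by (simp_all add: field_simps)
  have "pi * (y - sin (shift j)) = \<theta> + 2 * pi * real_of_int (- k)"
    by (simp add: y_def field_simps)
  then have ph: "phase j y = z"
    unfolding phase_def \<theta> by (simp only: cis_mult[symmetric]) (metis Ints_of_int cis_multiple_2pi mult.right_neutral)
  define s0 where "s0 = (arcsin y - shift j) / (2 * pi)"
  define s where "s = s0 + \<lceil>a - s0\<rceil>"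
  have "s \<in> {a..a+1}" unfolding s_def by (simp; linarith)
  moreover have "sin (2 * pi * s + shift j) = y"
  proof -
    have "2 * pi * s + shift j = arcsin y + 2 * pi * real_of_int \<lceil>a - s0\<rceil>"
      by (simp add: s_def s0_def field_simps)
    then show ?thesis
      using sin_cos_eq_iff[of "2 * pi * s + shift j" "arcsin y"] sin_arcsin[OF y] by metis
  qed
  ultimately show ?thesis using ph by metis
qed

lemma circle_in_closure: "circle \<subseteq> closure (braid - circle)"
proof
  fix q assume "q \<in> circle"
  then obtain z where z: "norm z = 1" "q = pt z 0 0" by (auto simp: circle_def)
  show "q \<in> closure (braid - circle)"
    unfolding closure_approachable
  proof (intro allI impI)
    fix r :: real assume "r > 0"
    then obtain d where d: "d > 0" "\<And>x. x \<in> braid \<Longrightarrow> ht x < d \<Longrightarrow> dist x (pt (circ x) 0 0) < r"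
      using near_circle_braid by metis
    obtain s where s: "s \<in> {1/d + 1..1/d + 1 + 1}" "phase 0 (sin (2 * pi * s + shift 0)) = z"
      using phase_hit[OF z(1)] by blast
    have "0 < 1/d" using d(1) by simp
    moreover have "1/d + 1 \<le> s" using s(1) by simp
    ultimately have "s > 1/d" "s \<ge> 1" by linarith+
    then have s': "s > 0" "1/s < d" "1/s \<le> 1" using d(1) by (auto simp: field_simps)
    then have "strand 0 (1/s) \<in> ray 0" by (intro strand_in_ray) (auto simp: top_height_def)
    then have "strand 0 (1/s) \<in> braid - circle" unfolding braid_minus_circle by blast
    moreover have "dist (strand 0 (1/s)) q < r"
      using d(2)[of "strand 0 (1/s)"] calculation s' s(2) z(2) by simp
    ultimately show "\<exists>y\<in>braid - circle. dist y q < r" by blast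
  qed
qed

lemma connected_braid: "connected braid"
proof -
  have "braid - circle = (\<Union>n. upper n)"
  proof
    show "braid - circle \<subseteq> (\<Union>n. upper n)"
    proof
      fix x assume x: "x \<in> braid - circle"
      then have "0 < ht x" unfolding braid_minus_circle using ray_pos by blast
      then show "x \<in> (\<Union>n. upper n)"
        using small_top_height[of "ht x"] x by (auto simp: upper_eq intro: less_imp_le)
    qed
    show "(\<Union>n. upper n) \<subseteq> braid - circle"
    proof
      fix x assume "x \<in> (\<Union>n. upper n)"
      then obtain n where "x \<in> braid" "top_height n \<le> ht x" by (auto simp: upper_eq)
      then show "x \<in> braid - circle" using circle_pos[of x] top_height_pos[of n] by auto
    qed
  qed
  moreover have "connected (\<Union>n. upper n)"
  proof (rule connected_Union)
    have "strand 0 1 \<in> upper n" for n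
      using top_height_le_1[of n] by (force simp: upper_def top_height_def[of 0])
    then show "\<Inter>(range upper) \<noteq> {}" by blast
  qed (auto intro: path_connected_imp_connected path_connected_upper)
  ultimately have "connected (braid - circle)" by simp
  moreover have "braid \<subseteq> closure (braid - circle)"
    using circle_in_closure closure_subset[of "braid - circle"] by blast
  ultimately show ?thesis by (rule connected_intermediate_closure[OF _ Diff_subset])
qed

lemma circle_props: "compact circle" "path_connected circle" "circle \<noteq> {}" "circle \<subseteq> braid"
proof -
  show "compact circle" unfolding circle_def by (intro compact_continuous_image continuous_intros) auto
  show "path_connected circle" unfolding circle_def
    by (intro path_connected_continuous_image continuous_intros path_connected_sphere) auto
  show "circle \<noteq> {}" by (auto simp: circle_def intro!: exI[of _ 1])
  show "circle \<subseteq> braid" by (simp add: braid_def)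
qed

lemma strand_meet:
  assumes "strand i a = strand j a" "i \<noteq> j" "a > 0"
  shows "\<exists>m::int. 1 / a = real_of_int m"
proof -
  have "offset (strand i a) = offset (strand j a)" using assms(1) by simp
  then have "sin (pi / a) = 0"
    using assms(2,3) by (auto simp: field_simps)
  then obtain m :: int where "pi / a = real_of_int m * pi" using sin_zero_iff_int2 by blast
  then have "pi * (1 / a) = pi * real_of_int m" by simp
  then have "1 / a = real_of_int m" by (simp only: mult_left_cancel[OF pi_neq_zero])
  then show ?thesis ..
qed

text \<open>The block between two consecutive meeting heights consists of the strands \<open>0, ..., n\<close>, which are
  disjoint apart from their ends. If \<open>M\<close> misses a point \<open>strand j (c j)\<close> of each of them, cutting at
  these points divides \<open>M\<close> into an upper part \<open>U\<close> and a lower part \<open>L\<close>. Both are closed, and their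
  only possible common points are the cut points, so \<open>M\<close> would be disconnected.\<close>

lemma block_contained:
  assumes M: "M \<subseteq> braid" "compact M" "connected M" and q: "q \<in> M" "q \<in> circle" and p: "p \<in> M" "top_height n \<le> ht p"
  shows "\<exists>j\<le>n. strand j ` {top_height (Suc n)..top_height n} \<subseteq> M"
proof (rule ccontr)
  assume "\<not> ?thesis"
  then have "\<forall>j. \<exists>c. j \<le> n \<longrightarrow> c \<in> {top_height (Suc n)..top_height n} \<and> strand j c \<notin> M" by blast
  then obtain c where c: "\<And>j. j \<le> n \<Longrightarrow> top_height (Suc n) \<le> c j \<and> c j \<le> top_height n \<and> strand j (c j) \<notin> M"
    by (metis atLeastAtMost_iff)
  define U where "U = (M \<inter> {x. top_height n \<le> ht x}) \<union> M \<inter> (\<Union>j\<in>{..n}. strand j ` {c j..top_height n})"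
  define L where "L = (M \<inter> {x. ht x \<le> top_height (Suc n)}) \<union> M \<inter> (\<Union>j\<in>{..n}. strand j ` {top_height (Suc n)..c j})"
  have cpos: "0 < c j" if "j \<le> n" for j using c[OF that] less_le_trans[OF top_height_pos] by blast
  have clM: "closed M" using M(2) by (rule compact_imp_closed)
  have "closed {x. top_height n \<le> ht x}" "closed {x. ht x \<le> top_height (Suc n)}"
    using continuous_coords(2) by (auto intro!: closed_Collect_le continuous_intros)
  moreover have "closed (\<Union>j\<in>{..n}. strand j ` {c j..top_height n})"
    "closed (\<Union>j\<in>{..n}. strand j ` {top_height (Suc n)..c j})"
    using cpos by (auto intro!: closed_UN compact_imp_closed compact_strand)
  ultimately have cl: "closed U" "closed L"
    unfolding U_def L_def using clM by (auto intro!: closed_Un closed_Int)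
  have "M \<subseteq> U \<union> L"
  proof
    fix x assume x: "x \<in> M"
    show "x \<in> U \<union> L"
    proof (cases "top_height n \<le> ht x \<or> ht x \<le> top_height (Suc n)")
      case True
      then show ?thesis using x by (auto simp: U_def L_def)
    next
      case False
      then have h: "top_height (Suc n) < ht x" "ht x < top_height n" by auto
      have "x \<in> braid" using x M by blast
      then show ?thesis
      proof (cases rule: braid_cases)
        case 1
        then show ?thesis using h top_height_pos[of "Suc n"] by auto
      next
        case (2 j)
        have "j \<le> n"
        proof -
          have "top_height (Suc n) < top_height j" using h 2 by linarith
          then have "\<not> Suc n \<le> j" using top_height_le_iff[of j "Suc n"] by auto
          then show ?thesis by simp
        qed
        moreover have "x \<in> strand j ` {c j..top_height n} \<or> x \<in> strand j ` {top_height (Suc n)..c j}"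
        proof (cases "c j \<le> ht x")
          case True
          then show ?thesis using 2(3) h by (metis atLeastAtMost_iff imageI less_imp_le)
        next
          case False
          then show ?thesis using 2(3) h by (metis atLeastAtMost_iff imageI less_imp_le linorder_not_le)
        qed
        ultimately show ?thesis using x by (auto simp: U_def L_def)
      qed
    qed
  qed
  moreover have "U \<inter> L = {}"
  proof (rule ccontr)
    assume "U \<inter> L \<noteq> {}"
    then obtain x where x: "x \<in> U" "x \<in> L" by blast
    then have xM: "x \<in> M" by (auto simp: U_def)
    have lt: "top_height (Suc n) < top_height n" using top_height_le_iff[of n "Suc n"] by auto
    have ends: "False" if j: "j \<le> n" "x = strand j (c j)" for j using c[OF j(1)] xM j by auto
    consider "top_height n \<le> ht x" "ht x \<le> top_height (Suc n)"
      | j where "top_height n \<le> ht x" "j \<le> n" "x \<in> strand j ` {top_height (Suc n)..c j}"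
      | i where "ht x \<le> top_height (Suc n)" "i \<le> n" "x \<in> strand i ` {c i..top_height n}"
      | i j where "i \<le> n" "x \<in> strand i ` {c i..top_height n}" "j \<le> n" "x \<in> strand j ` {top_height (Suc n)..c j}"
      using x unfolding U_def L_def by blast
    then show False
    proof cases
      case 1
      then show ?thesis using lt by linarith
    next
      case (2 j)
      then obtain b where b: "x = strand j b" "b \<le> c j" by auto
      then have "b = c j" using 2 c[OF 2(2)] by auto
      then show ?thesis using ends 2 b by blast
    next
      case (3 i)
      then obtain a where a: "x = strand i a" "c i \<le> a" by auto
      then have "a = c i" using 3 c[OF 3(2)] by auto
      then show ?thesis using ends 3 a by blast
    next
      case (4 i j)
      obtain a where a: "x = strand i a" "c i \<le> a" "a \<le> top_height n" using 4(2) by auto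
      obtain b where b: "x = strand j b" "top_height (Suc n) \<le> b" "b \<le> c j" using 4(4) by auto
      have ab: "a = b" using a(1) b(1) strand_simps(1) by metis
      show ?thesis
      proof (cases "i = j")
        case True
        then show ?thesis using ends[OF 4(1)] a b ab by auto
      next
        case False
        have a0: "a > 0" using b(2) ab less_le_trans[OF top_height_pos] by blast
        obtain m :: int where m: "1 / a = real_of_int m"
          using strand_meet[of i a j] a(1) b(1) ab False a0 by auto
        have "real n + 1 \<le> 1 / a" "1 / a \<le> real n + 2"
          using a(3) b(2) ab a0 by (auto simp: top_height_def field_simps)
        then have "int n + 1 \<le> m" "m \<le> int n + 2" unfolding m by linarith+
        then have "m = int n + 1 \<or> m = int n + 2" by linarith
        then have "1 / a = real n + 1 \<or> 1 / a = real n + 2" using m by auto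
        then have "a = top_height n \<or> a = top_height (Suc n)"
          using a0 by (auto simp: top_height_def field_simps)
        then have "b = c j \<or> a = c i"
          using a b c[OF 4(1)] c[OF 4(3)] ab by auto
        then show ?thesis using ends[OF 4(1)] ends[OF 4(3)] a(1) b(1) by auto
      qed
    qed
  qed
  moreover have "p \<in> U" using p by (simp add: U_def)
  moreover have "q \<in> L" using q circle_pos less_imp_le[OF top_height_pos] by (auto simp: L_def)
  ultimately show False
    using connected_closedD[OF M(3) _ _ cl] p(1) q(1) by blast
qed

text \<open>Every low block contains a strand that lies in \<open>M\<close> and passes over every point of the circle, so
  each point of the circle is a limit of points of \<open>M\<close>.\<close>

lemma swallow_circle:
  assumes M: "M \<subseteq> braid" "compact M" "connected M" and q: "q \<in> M" "q \<in> circle" and p: "p \<in> M" "p \<notin> circle"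
  shows "circle \<subseteq> M"
proof
  fix x assume "x \<in> circle"
  then obtain z where z: "norm z = 1" "x = pt z 0 0" by (auto simp: circle_def)
  have "p \<in> braid - circle" using M p by blast
  then have hp: "0 < ht p" unfolding braid_minus_circle using ray_pos by blast
  have "x \<in> closure M"
    unfolding closure_approachable
  proof (intro allI impI)
    fix r :: real assume "r > 0"
    then obtain d where d: "d > 0" "\<And>x. x \<in> braid \<Longrightarrow> ht x < d \<Longrightarrow> dist x (pt (circ x) 0 0) < r"
      using near_circle_braid by metis
    obtain n where n: "top_height n < min d (ht p)" using small_top_height[of "min d (ht p)"] d hp by auto
    then obtain j where j: "strand j ` {top_height (Suc n)..top_height n} \<subseteq> M"
      using block_contained[OF M q p(1), of n] by auto
    obtain s where s: "s \<in> {real n + 1..real n + 1 + 1}" "phase j (sin (2 * pi * s + shift j)) = z"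
      using phase_hit[OF z(1)] by blast
    have s': "top_height (Suc n) \<le> 1/s" "1/s \<le> top_height n"
      using s(1) by (auto simp: top_height_def field_simps)
    then have "strand j (1/s) \<in> M" using j by auto
    moreover have "dist (strand j (1/s)) x < r"
      using d(2)[of "strand j (1/s)"] calculation M(1) s'(2) n s(2) z(2) by auto
    ultimately show "\<exists>y\<in>M. dist y x < r" by blast
  qed
  then show "x \<in> M" using compact_imp_closed[OF M(2)] by simp
qed

section \<open>Limits of subarcs of the rays\<close>

global_interpretation braid: metric_continuum braid
  using compact_braid connected_braid circle_props by unfold_locales auto

lemma ray_subset_braid: "ray j \<subseteq> braid"
  by (auto simp: braid_def)

lemma circle_in_CX: "circle \<in> braid.CX"
  using circle_props path_connected_imp_connected by (auto simp: braid.CX_def)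

lemma swallow_CX:
  assumes "M \<in> braid.CX" "M \<inter> circle \<noteq> {}" "\<not> M \<subseteq> circle"
  shows "circle \<subseteq> M"
proof -
  obtain p q where "q \<in> M" "q \<in> circle" "p \<in> M" "p \<notin> circle" using assms by blast
  then show ?thesis using swallow_circle[of M q p] assms(1) by (auto simp: braid.CX_def)
qed

lemma ht_attains_positive_min:
  assumes "compact K" "K \<noteq> {}" "\<And>x. x \<in> K \<Longrightarrow> 0 < ht x"
  obtains m where "0 < m" "\<And>x. x \<in> K \<Longrightarrow> m \<le> ht x" "\<exists>x\<in>K. ht x = m"
proof -
  obtain x where "x \<in> K" "\<forall>y\<in>K. ht x \<le> ht y"
    using continuous_attains_inf[OF assms(1,2) continuous_coords(2)] by blast
  then show ?thesis using that[of "ht x"] assms(3) by blast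
qed

lemma complement_path_exhausted: "braid.path_exhausted (braid - circle)"
  unfolding braid.path_exhausted_def
proof (intro allI impI)
  fix K assume "compact K \<and> K \<noteq> {} \<and> K \<subseteq> braid - circle"
  then have K: "compact K" "K \<noteq> {}" "K \<subseteq> braid - circle" by auto
  have pos: "0 < ht x" if "x \<in> K" for x
    using that K(3) ray_pos unfolding braid_minus_circle by blast
  obtain m where m: "0 < m" "\<And>x. x \<in> K \<Longrightarrow> m \<le> ht x"
    using ht_attains_positive_min[OF K(1,2) pos] by metis
  obtain n where n: "top_height n < m" using small_top_height m by blast
  have "K \<subseteq> upper n"
  proof
    fix x assume "x \<in> K"
    then show "x \<in> upper n" using K(3) m(2)[of x] n by (auto simp: upper_eq)
  qed
  moreover have "upper n \<subseteq> braid - circle"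
  proof
    fix x assume "x \<in> upper n"
    then have "x \<in> braid" "top_height n \<le> ht x" by (auto simp: upper_eq)
    then show "x \<in> braid - circle" using circle_pos[of x] top_height_pos[of n] by auto
  qed
  moreover have "upper n \<in> braid.CX"
    using calculation K(2) compact_upper path_connected_imp_connected[OF path_connected_upper]
    by (auto simp: braid.CX_def)
  ultimately show "\<exists>N\<in>braid.CX. K \<subseteq> N \<and> N \<subseteq> braid - circle \<and> path_connected N"
    using path_connected_upper by blast
qed

lemma ray_path_exhausted: "braid.path_exhausted (ray j)"
  unfolding braid.path_exhausted_def
proof (intro allI impI)
  fix K assume "compact K \<and> K \<noteq> {} \<and> K \<subseteq> ray j"
  then have K: "compact K" "K \<noteq> {}" "K \<subseteq> ray j" by auto
  have pos: "0 < ht x" if "x \<in> K" for x using that K(3) ray_pos by blast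
  obtain m where m: "0 < m" "\<And>x. x \<in> K \<Longrightarrow> m \<le> ht x"
    using ht_attains_positive_min[OF K(1,2) pos] by metis
  define N where "N = strand j ` {m..top_height j}"
  have KN: "K \<subseteq> N"
  proof
    fix x assume x: "x \<in> K"
    then have "ht x \<le> top_height j" "x = strand j (ht x)" using K(3) ray_pos[of x j] by blast+
    then show "x \<in> N" using m(2)[OF x] unfolding N_def by (metis atLeastAtMost_iff imageI)
  qed
  have Nr: "N \<subseteq> ray j" using m(1) by (auto simp: N_def intro: strand_in_ray)
  have pc: "path_connected N" unfolding N_def by (rule path_connected_strand[OF m(1)])
  have "N \<in> braid.CX"
    using KN Nr K(2) compact_strand[OF m(1), of j "top_height j"] path_connected_imp_connected[OF pc]
      ray_subset_braid[of j]
    unfolding braid.CX_def N_def[symmetric] by blast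
  then show "\<exists>N\<in>braid.CX. K \<subseteq> N \<and> N \<subseteq> ray j \<and> path_connected N"
    using KN Nr pc by blast
qed

text \<open>The set \<open>Y\<close> is lifted to the \<open>n\<close>-th swing of the strand: at time \<open>\<sigma> y\<close> the sine in the definition of
  the strand has the value \<open>y\<close>. For large \<open>n\<close> the lift is low, hence close to its projection.\<close>

lemma image_circle_in_closure:
  assumes Y: "compact Y" "connected Y" "Y \<noteq> {}" "Y \<subseteq> {-1..1}"
  shows "(\<lambda>y. pt (phase j y) 0 0) ` Y \<in> braid.H closure_of {A\<in>braid.CX. A \<subseteq> ray j}" (is "?K \<in> _")
proof -
  have KC: "?K \<in> braid.CX"
    using Y(1-3) by (intro braid.image_in_CX continuous_intros) (auto simp: braid_def circle_def)
  have "\<exists>A\<in>{A\<in>braid.CX. A \<subseteq> ray j}. A \<in> braid.HM.mball ?K r" if r: "r > 0" for r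
  proof -
    from r have "r/2 > 0" by simp
    then obtain d where d: "d > 0" "\<And>x. x \<in> braid \<Longrightarrow> ht x < d \<Longrightarrow> dist x (pt (circ x) 0 0) < r/2"
      using near_circle_braid by metis
    define C where "C = (pi/2 + \<bar>shift j\<bar>) / (2*pi)"
    define n where "n = nat \<lceil>C + 1/d + real j + 2\<rceil>"
    define \<sigma> where "\<sigma> y = real n + (arcsin y - shift j) / (2*pi)" for y
    have n: "C + 1/d + real j + 2 \<le> real n" unfolding n_def by linarith
    have \<sigma>: "1/d + real j + 2 \<le> \<sigma> y" if "y \<in> Y" for y
    proof -
      have "-1 \<le> y" "y \<le> 1" using that Y(4) by auto
      then have "- (pi/2) \<le> arcsin y" using arcsin_bounded[of y] by simp
      then have "- (pi/2 + \<bar>shift j\<bar>) \<le> arcsin y - shift j" by linarith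
      then have "- C \<le> (arcsin y - shift j) / (2*pi)"
        unfolding C_def minus_divide_left by (rule divide_right_mono) simp
      then show ?thesis using n by (simp add: \<sigma>_def)
    qed
    have dp: "0 < 1/d" using d(1) by simp
    have \<sigma>': "0 < 1 / \<sigma> y" "1 / \<sigma> y \<le> top_height j" "1 / \<sigma> y < d" if "y \<in> Y" for y
    proof -
      have "0 < \<sigma> y" "real j + 1 \<le> \<sigma> y" "1/d < \<sigma> y" using \<sigma>[OF that] dp by linarith+
      then show "0 < 1 / \<sigma> y" "1 / \<sigma> y \<le> top_height j" "1 / \<sigma> y < d"
        using d(1) by (auto simp: top_height_def field_simps)
    qed
    define f where "f y = strand j (1 / \<sigma> y)" for y
    have circf: "circ (f y) = phase j y" if "y \<in> Y" for y
    proof -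
      have "2 * pi * \<sigma> y + shift j = arcsin y + 2 * pi * real_of_int (int n)"
        by (simp add: \<sigma>_def field_simps)
      then have "sin (2 * pi * \<sigma> y + shift j) = sin (arcsin y)"
        using sin_cos_eq_iff[of "2 * pi * \<sigma> y + shift j" "arcsin y"] by metis
      then show ?thesis using that Y(4) by (auto simp: f_def)
    qed
    have fr: "f y \<in> ray j" if "y \<in> Y" for y
      using \<sigma>'[OF that] by (auto simp: f_def intro: strand_in_ray)
    have near: "dist (f y) (pt (phase j y) 0 0) < r/2" if "y \<in> Y" for y
      using d(2)[of "f y"] fr[OF that] \<sigma>'(3)[OF that] circf[OF that] by (auto simp: braid_def f_def)
    have "continuous_on Y arcsin" by (rule continuous_on_subset[OF continuous_on_arcsin' Y(4)])
    then have "continuous_on Y \<sigma>"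
      unfolding \<sigma>_def
      by (intro continuous_on_add continuous_on_divide continuous_on_diff continuous_on_const) simp_all
    moreover have "\<forall>y\<in>Y. \<sigma> y \<noteq> 0" using \<sigma>'(1) by force
    ultimately have c1: "continuous_on Y (\<lambda>y. 1 / \<sigma> y)"
      by (intro continuous_on_divide continuous_on_const)
    have "continuous_on Y f"
      unfolding f_def
      by (rule continuous_on_compose2[OF continuous_on_strand[of "{0<..}"] c1]) (use \<sigma>'(1) in auto)
    then have fC: "f ` Y \<in> braid.CX"
      using Y(1-3) fr by (intro braid.image_in_CX) (auto simp: braid_def)
    have "braid.hdist ?K (f ` Y) \<le> r/2"
    proof (rule braid.hd_le[OF KC fC])
      fix a assume "a \<in> ?K"
      then obtain y where "y \<in> Y" "a = pt (phase j y) 0 0" by blast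
      then show "\<exists>b\<in>f ` Y. dist a b \<le> r/2" using near[of y] by (auto simp: dist_commute intro: less_imp_le)
    next
      fix b assume "b \<in> f ` Y"
      then obtain y where "y \<in> Y" "b = f y" by blast
      then show "\<exists>a\<in>?K. dist b a \<le> r/2" using near[of y] by (auto intro: less_imp_le)
    qed
    then have "f ` Y \<in> braid.HM.mball ?K r" using KC fC r by simp
    moreover have "f ` Y \<subseteq> ray j" using fr by blast
    ultimately show ?thesis using fC by blast
  qed
  then show ?thesis using KC unfolding braid.H_eq braid.HM.metric_closure_of by blast
qed

lemma cis_eq_iff: "cis a = cis b \<longleftrightarrow> (\<exists>n::int. a = b + 2 * pi * n)"
  using sin_cos_eq_iff[of a b] by (auto simp: complex_eq_iff)

lemma phase_eq_iff: "phase j y = phase j y' \<longleftrightarrow> (\<exists>n::int. y = y' + 2 * n)"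
proof -
  have "pi * (y - sin (shift j)) = pi * (y' - sin (shift j)) + 2 * pi * of_int n \<longleftrightarrow> y = y' + 2 * of_int n" for n :: int
  proof -
    have "pi * (y - sin (shift j)) = pi * (y' - sin (shift j)) + 2 * pi * of_int n \<longleftrightarrow>
      pi * (y - sin (shift j)) = pi * (y' - sin (shift j) + 2 * of_int n)" by (simp add: algebra_simps)
    also have "\<dots> \<longleftrightarrow> y - sin (shift j) = y' - sin (shift j) + 2 * of_int n"
      by (rule mult_left_cancel) simp
    finally show ?thesis by auto
  qed
  then show ?thesis by (simp add: phase_def cis_eq_iff)
qed

lemma phase_inj:
  assumes "phase j y = phase j y'" "\<bar>y - y'\<bar> < 2"
  shows "y = y'"
proof -
  obtain n :: int where n: "y = y' + 2 * real_of_int n" using assms(1) phase_eq_iff by blast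
  then have "n = 0" using assms(2) by linarith
  then show ?thesis using n by simp
qed

text \<open>Going from \<open>y2\<close> up to \<open>y1\<close> leads through \<open>y0\<close>, whereas \<open>K\<close> connects the two ends across the cut point.
  A subcontinuum \<open>A\<close> of the ray cannot cross there: its sine value \<open>h\<close> is a continuous real function,
  so if \<open>A\<close> comes near both points of \<open>K\<close>, it attains \<open>y0\<close> and has a point over \<open>phase j y0\<close>, away from
  \<open>K\<close>. The open sets \<open>U0\<close>, \<open>U1\<close>, \<open>U2\<close> express this as a Vietoris neighbourhood of \<open>K\<close>.\<close>

lemma ray_avoids_across_cut:
  assumes y: "-1 < y2" "y2 < y0" "y0 < y1" "y1 < 1"
    and K: "K \<in> braid.CX" "K \<subseteq> circle"
    and K12: "pt (phase j y1) 0 0 \<in> K" "pt (phase j y2) 0 0 \<in> K" "pt (phase j y0) 0 0 \<notin> K"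
  shows "K \<notin> braid.H closure_of {A\<in>braid.CX. A \<subseteq> ray j}"
proof
  assume Kcl: "K \<in> braid.H closure_of {A\<in>braid.CX. A \<subseteq> ray j}"
  define U1 where "U1 = - (circ -` (phase j ` {-1..y0}))"
  define U2 where "U2 = - (circ -` (phase j ` {y0..1}))"
  define U0 where "U0 = - (circ -` {phase j y0})"
  have "closed (phase j ` {a..b})" for a b
    by (intro compact_imp_closed compact_continuous_image continuous_intros) auto
  then have op: "open U1" "open U2" "open U0"
    unfolding U1_def U2_def U0_def open_closed
    by (auto intro!: closed_vimage continuous_coords)
  define V where "V = {A\<in>braid.CX. A \<inter> U1 \<noteq> {}} \<inter> {A\<in>braid.CX. A \<inter> U2 \<noteq> {}} \<inter> {A\<in>braid.CX. A \<subseteq> U0}"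
  have "openin braid.H V"
    unfolding V_def by (intro openin_Int braid.openin_hit braid.openin_inside op)
  moreover have "K \<in> V"
  proof -
    have "phase j y1 \<notin> phase j ` {-1..y0}"
    proof
      assume "phase j y1 \<in> phase j ` {-1..y0}"
      then obtain y' where y': "phase j y1 = phase j y'" "-1 \<le> y'" "y' \<le> y0" by auto
      then have "y1 = y'" using y by (intro phase_inj[of j]) auto
      then show False using y' y by simp
    qed
    moreover have "phase j y2 \<notin> phase j ` {y0..1}"
    proof
      assume "phase j y2 \<in> phase j ` {y0..1}"
      then obtain y' where y': "phase j y2 = phase j y'" "y0 \<le> y'" "y' \<le> 1" by auto
      then have "y2 = y'" using y by (intro phase_inj[of j]) auto
      then show False using y' y by simp
    qed
    ultimately have "pt (phase j y1) 0 0 \<in> U1" "pt (phase j y2) 0 0 \<in> U2"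
      by (simp_all add: U1_def U2_def)
    moreover have "K \<subseteq> U0"
    proof
      fix x assume "x \<in> K"
      then have "x = pt (circ x) 0 0" using K(2) by (auto simp: circle_def)
      then show "x \<in> U0" using \<open>x \<in> K\<close> K12(3) by (auto simp: U0_def)
    qed
    ultimately show ?thesis using K12 K(1) unfolding V_def by blast
  qed
  ultimately obtain A where A: "A \<in> braid.CX" "A \<subseteq> ray j" "A \<in> V"
    using Kcl unfolding in_closure_of by blast
  define h where "h x = sin (2 * pi / ht x + shift j)" for x
  have hA: "0 < ht x" "circ x = phase j (h x)" if "x \<in> A" for x
  proof -
    have "x \<in> ray j" using that A(2) by blast
    then show "0 < ht x" "circ x = phase j (h x)"
      using ray_pos[of x j] strand_simps(2)[of j "ht x"] by (auto simp: h_def)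
  qed
  have hb: "-1 \<le> h x" "h x \<le> 1" for x by (auto simp: h_def)
  obtain x1 x2 where x: "x1 \<in> A" "x1 \<in> U1" "x2 \<in> A" "x2 \<in> U2" and A0: "A \<subseteq> U0"
    using A(3) unfolding V_def by blast
  have "h x1 \<notin> {-1..y0}" using x(2) hA(2)[OF x(1)] unfolding U1_def by auto
  then have h1: "y0 \<le> h x1" using hb[of x1] by auto
  have "h x2 \<notin> {y0..1}" using x(4) hA(2)[OF x(3)] unfolding U2_def by auto
  then have h2: "h x2 \<le> y0" using hb[of x2] by auto
  have "continuous_on A h"
    unfolding h_def using hA(1) by (intro continuous_intros continuous_coords) force
  then have "connected (h ` A)" using connected_continuous_image braid.CXD(4)[OF A(1)] by blast
  then have "y0 \<in> h ` A"
    using connected_contains_Icc[of "h ` A" "h x2" "h x1"] x h1 h2 by (auto simp: subset_iff)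
  then obtain x where "x \<in> A" "circ x = phase j y0" using hA by auto
  then show False using A0 by (auto simp: U0_def)
qed

lemma circle_arc_parametrization:
  assumes C: "C \<subseteq> sphere 0 1" "compact C" "connected C" "cis \<theta>0 \<notin> C"
  obtains I where "compact I" "connected I" "I \<subseteq> {\<theta>0<..<\<theta>0 + 2 * pi}" "cis ` I = C"
proof -
  define f where "f z = \<theta>0 + pi + Arg (z * cis (- \<theta>0 - pi))" for z
  have nz: "z \<noteq> 0" "norm z = 1" if "z \<in> C" for z using that C(1) by force+
  have sgn: "sgn (z * cis a) = z * cis a" if "z \<in> C" for z a
    using nz[OF that] by (simp add: sgn_div_norm norm_mult)
  have ca: "cis (Arg (z * cis (- \<theta>0 - pi))) = z * cis (- \<theta>0 - pi)" if "z \<in> C" for z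
    using cis_Arg[of "z * cis (- \<theta>0 - pi)"] sgn[OF that] nz[OF that] by simp
  have cf: "cis (f z) = z" if "z \<in> C" for z
  proof -
    have "cis (f z) = cis (\<theta>0 + pi) * cis (Arg (z * cis (- \<theta>0 - pi)))"
      by (simp add: f_def cis_mult)
    also have "\<dots> = z * (cis (\<theta>0 + pi) * cis (- \<theta>0 - pi))" by (simp add: ca[OF that])
    also have "\<dots> = z" by (simp add: cis_mult)
    finally show ?thesis .
  qed
  have ne: "Arg (z * cis (- \<theta>0 - pi)) \<noteq> pi" if "z \<in> C" for z
  proof
    assume "Arg (z * cis (- \<theta>0 - pi)) = pi"
    then have "cis (\<theta>0 + 2 * pi) = z" using cf[OF that] by (simp add: f_def algebra_simps)
    moreover have "cis (\<theta>0 + 2 * pi) = cis \<theta>0" unfolding cis_eq_iff by (rule exI[of _ 1]) simp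
    ultimately show False using C(4) that by simp
  qed
  have rng: "f z \<in> {\<theta>0<..<\<theta>0 + 2 * pi}" if "z \<in> C" for z
    using Arg_bounded[of "z * cis (- \<theta>0 - pi)"] ne[OF that] by (auto simp: f_def)
  have "continuous_on C f"
    unfolding f_def
  proof (intro continuous_intros)
    fix z assume z: "z \<in> C"
    have off: "w \<notin> \<real>\<^sub>\<le>\<^sub>0" if "w \<noteq> 0" "Arg w \<noteq> pi" for w
      using that by (auto simp: complex_nonpos_Reals_iff Arg_eq_pi complex_eq_iff)
    show "z * cis (- \<theta>0 - pi) \<notin> \<real>\<^sub>\<le>\<^sub>0"
      by (rule off[OF _ ne[OF z]]) (use nz[OF z] in simp)
  qed
  then have "compact (f ` C)" "connected (f ` C)"
    using compact_continuous_image[OF _ C(2)] connected_continuous_image[OF _ C(3)] by simp_all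
  moreover have "cis ` f ` C = C" using cf by force
  ultimately show ?thesis using that[of "f ` C"] rng by blast
qed

lemma circle_subset_eq: "K \<subseteq> circle \<Longrightarrow> (\<lambda>z. pt z 0 0) ` circ ` K = K"
  by (force simp: circle_def)

lemma circ_image:
  assumes "K \<in> braid.CX" "K \<subseteq> circle"
  shows "circ ` K \<subseteq> sphere 0 1" "compact (circ ` K)" "connected (circ ` K)" "circ ` K \<noteq> {}"
  using assms braid.CXD[OF assms(1)] continuous_coords(1)
  by (auto simp: circle_def intro!: compact_continuous_image connected_continuous_image)

lemma ray_accumulates_off_cut:
  assumes K: "K \<in> braid.CX" "K \<subseteq> circle" and cut: "pt (phase j 1) 0 0 \<notin> K"
  shows "K \<in> braid.H closure_of {A\<in>braid.CX. A \<subseteq> ray j}"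
proof -
  define \<theta> where "\<theta> = pi * (- 1 - sin (shift j))"
  have "phase j (-1) = phase j 1" unfolding phase_eq_iff by (rule exI[of _ "-1"]) simp
  then have "cis \<theta> = phase j 1" unfolding \<theta>_def phase_def .
  then have "cis \<theta> \<notin> circ ` K" using cut circle_subset_eq[OF K(2)] by (metis imageI)
  then obtain I where I: "compact I" "connected I" "I \<subseteq> {\<theta><..<\<theta> + 2 * pi}" "cis ` I = circ ` K"
    using circle_arc_parametrization[OF circ_image(1-3)[OF K]] by blast
  define g where "g t = t / pi + sin (shift j)" for t
  have gp: "phase j (g t) = cis t" for t by (simp add: phase_def g_def)
  have cg: "continuous_on I g" unfolding g_def by (intro continuous_intros) simp
  have "g ` I \<subseteq> {-1..1}"
  proof
    fix y assume "y \<in> g ` I"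
    then obtain t where "y = g t" "\<theta> < t" "t < \<theta> + 2 * pi" using I(3) by auto
    then have "pi * (-1) < pi * y" "pi * y < pi * 1" by (simp_all add: g_def \<theta>_def algebra_simps)
    then show "y \<in> {-1..1}" using mult_less_cancel_left_pos[OF pi_gt_zero] by (metis atLeastAtMost_iff less_imp_le)
  qed
  moreover have "g ` I \<noteq> {}" using I(4) circ_image(4)[OF K] by auto
  ultimately have "(\<lambda>y. pt (phase j y) 0 0) ` g ` I \<in> braid.H closure_of {A\<in>braid.CX. A \<subseteq> ray j}"
    using compact_continuous_image[OF cg I(1)] connected_continuous_image[OF cg I(2)]
    by (intro image_circle_in_closure) auto
  moreover have "(\<lambda>y. pt (phase j y) 0 0) ` g ` I = K"
  proof -
    have "(\<lambda>y. pt (phase j y) 0 0) ` g ` I = (\<lambda>z. pt z 0 0) ` cis ` I" by (simp add: image_image gp)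
    then show ?thesis unfolding I(4) circle_subset_eq[OF K(2)] .
  qed
  ultimately show ?thesis by simp
qed

lemma circle_in_ray_closure: "circle \<in> braid.H closure_of {A\<in>braid.CX. A \<subseteq> ray j}"
proof -
  have "(\<lambda>y. pt (phase j y) 0 0) ` {-1..1} = circle"
  proof
    show "circle \<subseteq> (\<lambda>y. pt (phase j y) 0 0) ` {-1..1}"
    proof
      fix x assume "x \<in> circle"
      then obtain z where z: "norm z = 1" "x = pt z 0 0" by (auto simp: circle_def)
      obtain s where "phase j (sin (2 * pi * s + shift j)) = z" using phase_hit[OF z(1)] by blast
      moreover have "sin (2 * pi * s + shift j) \<in> {-1..1}" by simp
      ultimately show "x \<in> (\<lambda>y. pt (phase j y) 0 0) ` {-1..1}" using z(2) by blast
    qed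
  qed (auto simp: circle_def)
  then show ?thesis using image_circle_in_closure[of "{-1..1}" j] by simp
qed

text \<open>The cut point of the \<open>j\<close>-th ray is \<open>phase j 1\<close>, at the angle \<open>pi * (1 - sin (shift j))\<close>. Angles of this form
  with a real number in place of \<open>shift j\<close> take every value modulo \<open>2 * pi\<close>, and the shifts are dense.\<close>

lemma cut_position:
  assumes "a < b"
  shows "\<exists>j. \<exists>k::int. a < pi * (1 - sin (shift j)) + 2 * pi * k \<and> pi * (1 - sin (shift j)) + 2 * pi * k < b"
proof -
  define c where "c = (a + b) / 2"
  define k where "k = \<lfloor>c / (2 * pi)\<rfloor>"
  define r where "r = c / pi - 2 * k"
  have c: "a < c" "c < b" using assms by (auto simp: c_def)
  have "real_of_int k \<le> c / (2 * pi)" "c / (2 * pi) < real_of_int k + 1" unfolding k_def by linarith+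
  moreover have "c / pi = 2 * (c / (2 * pi))" by simp
  ultimately have r: "0 \<le> r" "r < 2" unfolding r_def by linarith+
  define f where "f x = pi * (1 - sin x) + 2 * pi * k" for x
  have "f (arcsin (1 - r)) = c"
    using r by (simp add: f_def) (simp add: r_def algebra_simps)
  moreover have "open (f -` {a<..<b})"
    unfolding f_def by (intro open_vimage continuous_intros open_greaterThanLessThan)
  ultimately obtain e where e: "e > 0" "ball (arcsin (1 - r)) e \<subseteq> f -` {a<..<b}"
    using c by (metis greaterThanLessThan_iff open_contains_ball vimage_eq)
  obtain j where "arcsin (1 - r) < shift j" "shift j < arcsin (1 - r) + e"
    using shift_dense[of "arcsin (1 - r)" "arcsin (1 - r) + e"] e(1) by auto
  then have "shift j \<in> ball (arcsin (1 - r)) e" by (auto simp: dist_real_def)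
  then have "f (shift j) \<in> {a<..<b}" using e(2) by blast
  then show ?thesis unfolding f_def by auto
qed

text \<open>Write \<open>K1\<close> as the image of an interval \<open>I\<close> of angles between \<open>\<theta>0\<close> and \<open>\<theta>0 + 2 * pi\<close>, where \<open>\<theta>0\<close> is the angle
  of a point outside \<open>K1\<close>. Some subinterval from \<open>\<theta>1\<close> to \<open>\<theta>2\<close> of \<open>I\<close> avoids \<open>K2\<close>. A ray with its cut point
  strictly inside this subinterval accumulates at \<open>K2\<close>, which misses the cut point, but not at \<open>K1\<close>,
  which contains points on both sides of it.\<close>

lemma separating_ray:
  assumes K1: "K1 \<in> braid.CX" "K1 \<subseteq> circle" and K2: "K2 \<in> braid.CX" "K2 \<subseteq> circle"
    and ne: "K1 \<noteq> circle" "\<not> K1 \<subseteq> K2" "x \<in> K1" "y \<in> K1" "x \<noteq> y"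
  shows "\<exists>j. K2 \<in> braid.H closure_of {A\<in>braid.CX. A \<subseteq> ray j} \<and>
    K1 \<notin> braid.H closure_of {A\<in>braid.CX. A \<subseteq> ray j}"
proof -
  have "circ ` K1 \<noteq> sphere 0 1" using ne(1) circle_subset_eq[OF K1(2)] unfolding circle_def by metis
  then have "\<not> sphere 0 1 \<subseteq> circ ` K1" using circ_image(1)[OF K1] by blast
  then obtain z0 where z0: "z0 \<in> sphere 0 1" "z0 \<notin> circ ` K1" by blast
  obtain \<theta>0 where t0: "z0 = cis \<theta>0" using z0(1) cis_Arg[of z0]
    by (metis mem_sphere_0 norm_eq_zero sgn_div_norm div_by_1 inverse_1 one_neq_zero scaleR_one)
  then obtain I where I: "compact I" "connected I" "I \<subseteq> {\<theta>0<..<\<theta>0 + 2 * pi}" "cis ` I = circ ` K1"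
    using circle_arc_parametrization[OF circ_image(1-3)[OF K1], of \<theta>0] z0(2) by blast
  have "(\<lambda>t. pt (cis t) 0 0) ` I = (\<lambda>z. pt z 0 0) ` cis ` I" by (simp add: image_image)
  then have KI: "K1 = (\<lambda>t. pt (cis t) 0 0) ` I"
    unfolding I(4) circle_subset_eq[OF K1(2)] by (rule sym)
  have Icc: "{a..b} \<subseteq> I" if "a \<in> I" "b \<in> I" for a b
    using connected_contains_Icc[OF I(2)] that by blast
  have "open (- K2)" using braid.CXD(5)[OF K2(1)] by (simp add: open_closed)
  moreover have "continuous_on UNIV (\<lambda>t. pt (cis t) 0 0)" by (intro continuous_intros)
  ultimately have opV: "open ((\<lambda>t. pt (cis t) 0 0) -` (- K2))"
    by (simp add: open_vimage)
  obtain p where p: "p \<in> I" "pt (cis p) 0 0 \<notin> K2" using ne(2) KI by blast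
  then obtain e where e: "e > 0" "ball p e \<subseteq> (\<lambda>t. pt (cis t) 0 0) -` (- K2)"
    using opV by (metis ComplI open_contains_ball vimageI)
  obtain q where q: "q \<in> I" "q \<noteq> p" using ne(3-5) KI by blast
  obtain \<theta>1 \<theta>2 where t12: "\<theta>1 < \<theta>2" "\<theta>1 \<in> I" "\<theta>2 \<in> I" "{\<theta>1..\<theta>2} \<subseteq> ball p e"
  proof (cases "p < q")
    case True
    have "min q (p + e/2) \<in> I" using Icc[OF p(1) q(1)] True e(1) by auto
    moreover have "{p..min q (p + e/2)} \<subseteq> ball p e"
      by (rule subsetI) (use e(1) in \<open>simp add: dist_real_def\<close>)
    ultimately show ?thesis using that[of p "min q (p + e/2)"] p True e(1) by auto
  next
    case False
    then have "q < p" using q(2) by simp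
    then have "max q (p - e/2) \<in> I" using Icc[OF q(1) p(1)] e(1) by auto
    moreover have "{max q (p - e/2)..p} \<subseteq> ball p e"
      by (rule subsetI) (use e(1) in \<open>simp add: dist_real_def\<close>)
    ultimately show ?thesis using that[of "max q (p - e/2)" p] p \<open>q < p\<close> e(1) by auto
  qed
  obtain j and k :: int where jk: "\<theta>1 < pi * (1 - sin (shift j)) + 2 * pi * k"
    "pi * (1 - sin (shift j)) + 2 * pi * k < \<theta>2"
    using cut_position[OF t12(1)] by blast
  \<comment> \<open>The angle of the cut point, in the range of \<open>I\<close>; \<open>1 + (t - \<theta>') / pi\<close> is the sine value at angle \<open>t\<close>.\<close>
  define \<theta>' where "\<theta>' = pi * (1 - sin (shift j)) + 2 * pi * k"
  have ph: "phase j (1 + (t - \<theta>') / pi) = cis t" for t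
  proof -
    have "pi * (1 + (t - \<theta>') / pi - sin (shift j)) = t + 2 * pi * of_int (- k)"
      by (simp add: \<theta>'_def field_simps)
    then show ?thesis unfolding phase_def cis_eq_iff by blast
  qed
  have "pt (cis \<theta>') 0 0 \<notin> K2" using jk t12(4) e(2) unfolding \<theta>'_def[symmetric] by (auto simp: subset_iff)
  then have "pt (phase j 1) 0 0 \<notin> K2" using ph[of \<theta>'] by simp
  then have "K2 \<in> braid.H closure_of {A\<in>braid.CX. A \<subseteq> ray j}"
    by (rule ray_accumulates_off_cut[OF K2])
  moreover have "K1 \<notin> braid.H closure_of {A\<in>braid.CX. A \<subseteq> ray j}"
  proof (rule ray_avoids_across_cut[OF _ _ _ _ K1])
    have b: "\<theta>0 < \<theta>1" "\<theta>2 < \<theta>0 + 2 * pi" using I(3) t12(2,3) by auto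
    have "(\<theta>2 - 2 * pi - \<theta>') / pi < (\<theta>0 - \<theta>') / pi"
      using b(2) by (intro divide_strict_right_mono) auto
    then show "1 + (\<theta>2 - 2 * pi - \<theta>') / pi < 1 + (\<theta>0 - \<theta>') / pi" by simp
    show "- 1 < 1 + (\<theta>2 - 2 * pi - \<theta>') / pi" "1 + (\<theta>0 - \<theta>') / pi < 1 + (\<theta>1 - \<theta>') / pi" "1 + (\<theta>1 - \<theta>') / pi < 1"
      using jk b unfolding \<theta>'_def[symmetric] by (simp_all add: field_simps)
    \<comment> \<open>Beyond the cut point the sine value jumps from \<open>1\<close> to \<open>-1\<close>, hence the shift by a full turn.\<close>
    have "cis (\<theta>2 - 2 * pi) = cis \<theta>2"
      unfolding cis_eq_iff by (rule exI[of _ "-1"]) simp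
    then show "pt (phase j (1 + (\<theta>1 - \<theta>') / pi)) 0 0 \<in> K1" "pt (phase j (1 + (\<theta>2 - 2 * pi - \<theta>') / pi)) 0 0 \<in> K1"
      unfolding ph using KI t12(2,3) by auto
    show "pt (phase j (1 + (\<theta>0 - \<theta>') / pi)) 0 0 \<notin> K1"
      unfolding ph using z0(2) t0 by (metis imageI pt_simps(1))
  qed
  ultimately show ?thesis by blast
qed

section \<open>A non-Wilder continuum with Wilder Whitney levels\<close>

interpretation wrapped_continuum braid circle
proof
  show "circle \<in> braid.CX" by (rule circle_in_CX)
  show "path_connected circle" by (rule circle_props)
  show "circle \<subseteq> M" if "M \<in> braid.CX" "M \<inter> circle \<noteq> {}" "\<not> M \<subseteq> circle" for M
    using swallow_CX that .
  show "braid.path_exhausted (braid - circle)" by (rule complement_path_exhausted)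
  fix K1 K2
  assume K: "K1 \<in> braid.CX" "K2 \<in> braid.CX" "K1 \<subseteq> circle" "K2 \<subseteq> circle" "K1 \<noteq> circle" "\<not> K1 \<subseteq> K2"
    and "\<nexists>x. K1 = {x}"
  then obtain x y where xy: "x \<in> K1" "y \<in> K1" "x \<noteq> y" using braid.CXD(2)[OF K(1)] by blast
  obtain j where j: "K2 \<in> braid.H closure_of {A\<in>braid.CX. A \<subseteq> ray j}"
    "K1 \<notin> braid.H closure_of {A\<in>braid.CX. A \<subseteq> ray j}"
    using separating_ray[OF K(1,3,2,4,5,6) xy] by blast
  have "ray j \<subseteq> braid - circle" unfolding braid_minus_circle by blast
  then show "\<exists>\<rho>\<subseteq>braid - circle. braid.path_exhausted \<rho> \<and>
      circle \<in> braid.H closure_of {A\<in>braid.CX. A \<subseteq> \<rho>} \<and> K2 \<in> braid.H closure_of {A\<in>braid.CX. A \<subseteq> \<rho>} \<and>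
      K1 \<notin> braid.H closure_of {A\<in>braid.CX. A \<subseteq> \<rho>}"
    using circle_in_ray_closure[of j] ray_path_exhausted[of j] j by (intro exI[of _ "ray j"] conjI)
qed

lemma not_wilder_braid: "\<not> wilder_continuum (top_of_set braid)"
proof
  assume W: "wilder_continuum (top_of_set braid)"
  define p where "p = strand 0 1"
  have p: "p \<in> braid - circle"
    unfolding braid_minus_circle p_def using strand_in_ray[of 1 0] by (auto simp: top_height_def)
  have c: "pt 1 0 0 \<in> circle" "pt (-1) 0 0 \<in> circle" by (auto simp: circle_def)
  have "p \<in> braid" "pt 1 0 0 \<in> braid" "pt (-1) 0 0 \<in> braid" using p c circle_props(4) by blast+
  moreover have "p \<noteq> pt 1 0 0" "p \<noteq> pt (-1) 0 0" using p c by blast+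
  moreover have "pt 1 0 0 \<noteq> pt (-1) 0 0" using pt_simps(1) by (metis one_neq_neg_one)
  moreover have "\<forall>x\<in>braid. \<forall>y\<in>braid. \<forall>z\<in>braid. x \<noteq> y \<and> x \<noteq> z \<and> y \<noteq> z \<longrightarrow>
      (\<exists>C. subcontinuum (top_of_set braid) C \<and> x \<in> C \<and> (y \<in> C \<longleftrightarrow> z \<notin> C))"
    using W by (simp add: wilder_continuum_def)
  ultimately obtain C where
    C: "subcontinuum (top_of_set braid) C" "p \<in> C" "pt 1 0 0 \<in> C \<longleftrightarrow> pt (-1) 0 0 \<notin> C"
    by metis
  have "C \<in> braid.CX" using C(1) braid.subcontinuum_X braid.mtopology_X by metis
  moreover have "C \<inter> circle \<noteq> {}" using C(3) c by blast
  moreover have "\<not> C \<subseteq> circle" using C(2) p by blast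
  ultimately have "circle \<subseteq> C" by (rule swallow_CX)
  then show False using C(3) c by blast
qed

theorem mainTheorem2:
  shows "\<not> whitney_reversible (wilder_continuum :: (nat \<Rightarrow> real) topology \<Rightarrow> bool)
             (wilder_continuum :: (nat \<Rightarrow> real) set topology \<Rightarrow> bool)
       \<and> (\<exists>X :: (nat \<Rightarrow> real) metric.
             continuum (mtopology_of X) \<and> \<not> wilder_continuum (mtopology_of X) \<and>
             (\<forall>\<mu>. whitney_map X \<mu> \<longrightarrow>
                (\<forall>t\<in>{0<..<\<mu> (mspace X)}. wilder_continuum (whitney_level X \<mu> t))))"
proof -
  let ?X = "submetric euclidean_metric braid"
  have cont: "continuum (mtopology_of ?X)"
    unfolding braid.mtopology_X using compact_braid connected_braid circle_props
    by (auto simp: braid.continuum_top_of_set)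
  have nw: "\<not> wilder_continuum (mtopology_of ?X)"
    unfolding braid.mtopology_X by (rule not_wilder_braid)
  have lev: "wilder_continuum (whitney_level ?X \<mu> t)"
    if \<mu>: "whitney_map ?X \<mu>" and t: "t \<in> {0<..<\<mu> (mspace ?X)}" for \<mu> t
  proof -
    interpret wrapped_whitney braid circle \<mu>
      by unfold_locales (rule \<mu>)
    have "whitney_level ?X \<mu> t = level braid t"
      unfolding whitney_level_def level_def braid.H_def braid.mspace_subcontinua_X
      using braid.CXD(1) by (auto intro!: arg_cong[of _ _ "subtopology (mtopology_of (subcontinua ?X))"])
    then show ?thesis using wilder_level[of t] t by simp
  qed
  show ?thesis
    unfolding whitney_reversible_def using cont nw lev by blast
qed

end
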